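(* Let $\boldsymbol{x}=(x_1,\dots,x_M)\in\mathbb{R}^M$ with $x_1<\cdots<x_M$ and $\boldsymbol{y}\in\mathbb{R}^M$ with $M\ge2$. Let $E:\mathbb{R}\times\mathbb{R}\to\mathbb{R}^+$ be such that $E(\cdot,y)$ is strictly convex, coercive, and differentiable for any $y\in\mathbb{R}$. Then the following hold. 1. There is a unique solution $(\beta_0^*,\beta_1^* )\in\mathbb{R}^2$ to the linear regression problem $$\min_{(\beta_0,\beta_1)\in\mathbb{R}^2}\sum_{m=1}^ME(\beta_0+\beta_1x_m,y_m).$$ Define $$\lambda_{\max}=\left\|(\mathbf{L}^T)^\dagger\begin{pmatrix}\partial_1E(\beta_0^*+\beta_1^*x_1,y_1)\\ \vdots\\ \partial_1E(\beta_0^*+\beta_1^*x_M,y_M)\end{pmatrix}\right\|_\infty .$$ 2. For any $\lambda\ge\lambda_{\max}$ (with $\lambda>0$), the solution of the discrete problem $$\min_{\boldsymbol{z}\in\mathbb{R}^M}\sum_{m=1}^ME(z_m,y_m)+\lambda\|\mathbf{L}\boldsymbol{z}\|_1$$ is $\boldsymbol{y}_\lambda=\beta_0^*\boldsymbol{1}+\beta_1^*\boldsymbol{x}$, where $\boldsymbol{1}=(1,\dots,1)\in\mathbb{R}^M$. 3. For any $\lambda\ge\lambda_{\max}$ (with $\lambda>0$), the solution to (gBLASSO) is unique and is the function $f_{\max}(x)=\beta_0^*+\beta_1^*x$.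
   Context: $\mathcal{M}(\mathbb{R})$ is the space of bounded (finite, signed) Radon measures on $\mathbb{R}$ with total-variation norm $\|\cdot\|_{\mathcal{M}}$. $\mathrm{BV}^{(2)}(\mathbb{R})=\{f\in\mathcal{S}'(\mathbb{R}):\mathrm{D}^2f\in\mathcal{M}(\mathbb{R})\}$, where $\mathrm{D}^2$ is the distributional second derivative; its elements are continuous functions. (gBLASSO), for $\lambda>0$, is the problem of minimizing $\sum_{m=1}^ME(f(x_m),y_m)+\lambda\|\mathrm{D}^2f\|_{\mathcal{M}}$ over $f\in\mathrm{BV}^{(2)}(\mathbb{R})$. $\partial_1E$ is the partial derivative of $E$ with respect to its first variable, and $^\dagger$ is the Moore–Penrose pseudoinverse. $\mathbf{L}\in\mathbb{R}^{(M-2)\times M}$ is the matrix defined by $(\mathbf{L}\boldsymbol{z})_i=v_iz_i-(v_i+v_{i+1})z_{i+1}+v_{i+1}z_{i+2}$ for $i=1,\dots,M-2$, where $v_m=\frac1{x_{m+1}-x_m}$ for $m=1,\dots,M-1$. *)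

theory Defs
  imports "HOL-Analysis.Analysis" "Jordan_Normal_Form.Matrix"
begin

(* From here on, $ is indexing of the variable-dimension vectors of Jordan_Normal_Form. *)
unbundle no vec_syntax

section \<open>Schwartz functions and tempered distributions on the real line\<close>

definition schwartz_seminorm :: "nat \<Rightarrow> nat \<Rightarrow> (real \<Rightarrow> real) \<Rightarrow> real" where
  "schwartz_seminorm k n \<phi> = (SUP t. \<bar>t ^ k * (deriv ^^ n) \<phi> t\<bar>)"

definition schwartz :: "(real \<Rightarrow> real) set" where
  "schwartz = {\<phi>. (\<forall>n t. (deriv ^^ n) \<phi> differentiable at t) \<and>
                  (\<forall>k n. bdd_above (range (\<lambda>t. \<bar>t ^ k * (deriv ^^ n) \<phi> t\<bar>)))}"

definition schwartz_topology :: "(real \<Rightarrow> real) topology" where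
  "schwartz_topology = topology_generated_by
     {{\<psi> \<in> schwartz. schwartz_seminorm k n (\<lambda>t. \<psi> t - \<phi> t) < \<epsilon>} | k n \<phi> \<epsilon>. \<phi> \<in> schwartz \<and> \<epsilon> > 0}"

type_synonym functional = "(real \<Rightarrow> real) \<Rightarrow> real"

(* Functionals are total in HOL, so they are normalised to "undefined" outside the
   Schwartz space; equality of distributions is then equality on Schwartz functions. *)
definition tempered_distributions :: "functional set" where
  "tempered_distributions =
     {T. T \<in> extensional schwartz \<and>
         (\<forall>\<phi>\<in>schwartz. \<forall>\<psi>\<in>schwartz. T (\<lambda>t. \<phi> t + \<psi> t) = T \<phi> + T \<psi>) \<and>
         (\<forall>c. \<forall>\<phi>\<in>schwartz. T (\<lambda>t. c * \<phi> t) = c * T \<phi>) \<and>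
         continuous_map schwartz_topology euclideanreal T}"

definition distributional_deriv :: "functional \<Rightarrow> functional" where
  "distributional_deriv T = (\<lambda>\<phi>\<in>schwartz. - T (deriv \<phi>))"

definition D2 :: "functional \<Rightarrow> functional" where
  "D2 T = distributional_deriv (distributional_deriv T)"

definition distribution_of :: "(real \<Rightarrow> real) \<Rightarrow> functional" where
  "distribution_of g = (\<lambda>\<phi>\<in>schwartz. LINT t|lborel. g t * \<phi> t)"

(* The second conjunct excludes the default value 0 of non-convergent integrals. *)
definition continuous_representative :: "functional \<Rightarrow> (real \<Rightarrow> real) \<Rightarrow> bool" where
  "continuous_representative T g \<longleftrightarrow>
     continuous_on UNIV g \<and>
     (\<forall>\<phi>\<in>schwartz. integrable lborel (\<lambda>t. g t * \<phi> t)) \<and>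
     T = distribution_of g"

(* A continuous representative is unique if it exists, and every element of BV2 below has
   one; point values are only used for those. *)
definition point_value :: "functional \<Rightarrow> real \<Rightarrow> real" where
  "point_value T = (THE g. continuous_representative T g)"


section \<open>Finite signed measures and the space $BV^{(2)}$\<close>

definition finite_borel_measure :: "real measure \<Rightarrow> bool" where
  "finite_borel_measure \<mu> \<longleftrightarrow> sets \<mu> = sets borel \<and> finite_measure \<mu>"

(* By the Jordan decomposition, the finite signed Borel measures are exactly the set
   functions P - N with P, N finite positive Borel measures. On the real line
   finite Borel measures are automatically Radon. *)
definition signed_decomposition ::
  "(real set \<Rightarrow> real) \<Rightarrow> real measure \<Rightarrow> real measure \<Rightarrow> bool" where
  "signed_decomposition \<nu> P N \<longleftrightarrow>
     finite_borel_measure P \<and> finite_borel_measure N \<and>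
     \<nu> = (\<lambda>A\<in>sets borel. measure P A - measure N A)"

definition radon_measures :: "(real set \<Rightarrow> real) set" where
  "radon_measures = {\<nu>. \<exists>P N. signed_decomposition \<nu> P N}"

definition total_variation :: "(real set \<Rightarrow> real) \<Rightarrow> real" where
  "total_variation \<nu> =
     (SUP \<P>\<in>{\<P>. finite \<P> \<and> \<P> \<subseteq> sets borel \<and> disjoint \<P> \<and> \<Union>\<P> = UNIV}. \<Sum>A\<in>\<P>. \<bar>\<nu> A\<bar>)"

(* The integral of a bounded Borel function against P - N does not depend on the choice of
   the decomposition. *)
definition represented_by_measure :: "functional \<Rightarrow> (real set \<Rightarrow> real) \<Rightarrow> bool" where
  "represented_by_measure T \<nu> \<longleftrightarrow>
     (\<exists>P N. signed_decomposition \<nu> P N \<and>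
        (\<forall>\<phi>\<in>schwartz. T \<phi> = (LINT t|P. \<phi> t) - (LINT t|N. \<phi> t)))"

(* The measure representing a functional is unique, since measures are normalised to
   "undefined" outside the Borel sets. *)
definition measure_norm :: "functional \<Rightarrow> real" where
  "measure_norm T = total_variation (THE \<nu>. represented_by_measure T \<nu>)"

definition BV2 :: "functional set" where
  "BV2 = {T \<in> tempered_distributions. \<exists>\<nu>\<in>radon_measures. represented_by_measure (D2 T) \<nu>}"


section \<open>The matrix L, the pseudoinverse and vector norms\<close>

(* Indices are 0-based: inv_gap x i stands for v with index i+1. *)
definition inv_gap :: "real vec \<Rightarrow> nat \<Rightarrow> real" where
  "inv_gap x i = 1 / (x $ (i + 1) - x $ i)"

definition L_mat :: "real vec \<Rightarrow> real mat" where
  "L_mat x = mat (dim_vec x - 2) (dim_vec x)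
     (\<lambda>(i, j). if j = i then inv_gap x i
               else if j = i + 1 then - (inv_gap x i + inv_gap x (i + 1))
               else if j = i + 2 then inv_gap x (i + 1)
               else 0)"

definition pseudoinverse :: "real mat \<Rightarrow> real mat" where
  "pseudoinverse A = (THE X. X \<in> carrier_mat (dim_col A) (dim_row A) \<and>
     A * X * A = A \<and> X * A * X = X \<and>
     transpose_mat (A * X) = A * X \<and> transpose_mat (X * A) = X * A)"

definition l1_norm :: "real vec \<Rightarrow> real" where
  "l1_norm v = (\<Sum>i<dim_vec v. \<bar>v $ i\<bar>)"

(* Inserting 0 only matters for the empty vector, whose norm is 0. *)
definition linf_norm :: "real vec \<Rightarrow> real" where
  "linf_norm v = Max (insert 0 ((\<lambda>i. \<bar>v $ i\<bar>) ` {..<dim_vec v}))"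


section \<open>The optimization problems\<close>

definition strictly_convex :: "(real \<Rightarrow> real) \<Rightarrow> bool" where
  "strictly_convex f \<longleftrightarrow>
     (\<forall>s t u. s \<noteq> t \<and> 0 < u \<and> u < 1 \<longrightarrow>
        f (u * s + (1 - u) * t) < u * f s + (1 - u) * f t)"

definition coercive :: "(real \<Rightarrow> real) \<Rightarrow> bool" where
  "coercive f \<longleftrightarrow> filterlim f at_top at_infinity"

definition regression_cost ::
  "(real \<Rightarrow> real \<Rightarrow> real) \<Rightarrow> real vec \<Rightarrow> real vec \<Rightarrow> real \<times> real \<Rightarrow> real" where
  "regression_cost E x y = (\<lambda>(\<beta>0, \<beta>1). \<Sum>m<dim_vec x. E (\<beta>0 + \<beta>1 * x $ m) (y $ m))"

definition discrete_cost ::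
  "(real \<Rightarrow> real \<Rightarrow> real) \<Rightarrow> real vec \<Rightarrow> real vec \<Rightarrow> real \<Rightarrow> real vec \<Rightarrow> real" where
  "discrete_cost E x y lam z =
     (\<Sum>m<dim_vec x. E (z $ m) (y $ m)) + lam * l1_norm (L_mat x *\<^sub>v z)"

definition gblasso_cost ::
  "(real \<Rightarrow> real \<Rightarrow> real) \<Rightarrow> real vec \<Rightarrow> real vec \<Rightarrow> real \<Rightarrow> functional \<Rightarrow> real" where
  "gblasso_cost E x y lam T =
     (\<Sum>m<dim_vec x. E (point_value T (x $ m)) (y $ m)) + lam * measure_norm (D2 T)"

definition lambda_max ::
  "(real \<Rightarrow> real \<Rightarrow> real) \<Rightarrow> real vec \<Rightarrow> real vec \<Rightarrow> real \<Rightarrow> real \<Rightarrow> real" where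
  "lambda_max E x y \<beta>0 \<beta>1 =
     linf_norm (pseudoinverse (transpose_mat (L_mat x)) *\<^sub>v
       vec (dim_vec x) (\<lambda>m. deriv (\<lambda>s. E s (y $ m)) (\<beta>0 + \<beta>1 * x $ m)))"

end

theory Submission
  imports Defs "HOL-Probability.Sinc_Integral" "Jordan_Normal_Form.Determinant"
begin

text \<open>The proof rests on a dual certificate. Let p be the regression line, which exists by coercivity
(\<open>regression_minimizer_exists\<close>), and e_m = \<partial>_1 E(p(x_m), y_m). Stationarity
of p says that e annihilates affine data, and strict convexity says that the fit of any other data
z exceeds that of p by strictly more than \<Sum>_m e_m z_m
(\<open>fit_above_minimal_line\<close>). Uniqueness of p is immediate, and for the penalized
problems it remains to show that -\<Sum>_m e_m z_m is at most lambda_max times the norm of Lz,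
respectively, for z_m = f(x_m), of the second derivative of f.

The certificate is the linear spline \<eta>(\<tau>) = \<Sum>_m e_m (x_m - \<tau>)_+. It has its
knots at the data and vanishes outside their range. Two summations by parts
(\<open>knot_values_pairing\<close>) give \<Sum>_m e_m z_m = \<Sum>_i \<eta>(x_(i+1)) (Lz)_i.
Hence the interior knot values solve L^T u = e; as L^T is injective, they are the pseudoinverse of
L^T applied to e, and as a linear spline is extremal at its knots, lambda_max = sup |\<eta>|. This
settles the discrete problem.

For the continuous problem, every element of BV2 with second derivative \<nu> is given by an
affine function plus \<integral> k(t,\<tau>) d\<nu>(\<tau>), where k(t,\<tau>) = (t-\<tau>)_+ -
(-\<tau>)_+ is bounded in \<tau> (\<open>BV2_continuous_representative\<close>). So \<Sum>_m e_m
f(x_m) = \<integral> \<eta> d\<nu>, which is bounded by lambda_max times the total variation of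
\<nu> (\<open>integral_le_total_variation\<close>). If f agrees with p at all data points, the
costs differ by \<lambda> times the total variation, which forces \<nu> = 0 and f = p for a
minimizer.

The representation needs three facts on Schwartz functions, all obtained from smooth windows and
their primitives: they separate finite measures (\<open>signed_measure_eqI_schwartz\<close>), they
separate continuous functions, and a linear functional vanishing on all second derivatives is an
affine function (\<open>schwartz_linear_vanishing_on_deriv2\<close>).\<close>

section \<open>Schwartz functions\<close>

text \<open>Every closure property of the Schwartz space below is an instance of this principle: exhibit a
family of rapidly decaying differentiable functions that the derivative maps into itself. No
formula for higher derivatives is then ever needed.\<close>

lemma schwartz_coinduct:
  assumes "f \<in> S"
    and "\<And>g t. g \<in> S \<Longrightarrow> g differentiable at t"
    and "\<And>g k. g \<in> S \<Longrightarrow> \<exists>C. \<forall>t. \<bar>t ^ k * g t\<bar> \<le> C"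
    and "\<And>g. g \<in> S \<Longrightarrow> deriv g \<in> S"
  shows "f \<in> schwartz"
proof -
  have "(deriv ^^ n) f \<in> S" for n
    by (induction n) (use assms in auto)
  with assms(2,3) show ?thesis
    unfolding schwartz_def bdd_above_def by fastforce
qed

lemma schwartz_deriv: "deriv \<phi> \<in> schwartz" if "\<phi> \<in> schwartz"
proof -
  have eq: "(deriv ^^ n) (deriv \<phi>) = (deriv ^^ Suc n) \<phi>" for n
    by (simp add: funpow_swap1)
  show "deriv \<phi> \<in> schwartz"
    using that unfolding schwartz_def mem_Collect_eq eq by fast
qed

lemma schwartz_DERIV: "(\<phi> has_real_derivative deriv \<phi> t) (at t)" if "\<phi> \<in> schwartz"
proof -
  have "(deriv ^^ 0) \<phi> differentiable at t" using that unfolding schwartz_def by blast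
  then show ?thesis by (simp add: DERIV_deriv_iff_real_differentiable)
qed

lemma schwartz_bound:
  assumes "\<phi> \<in> schwartz" obtains C where "\<And>t. \<bar>t ^ k * \<phi> t\<bar> \<le> C"
proof -
  have "bdd_above (range (\<lambda>t. \<bar>t ^ k * (deriv ^^ 0) \<phi> t\<bar>))"
    using assms unfolding schwartz_def mem_Collect_eq by fast
  then show ?thesis using that unfolding bdd_above_def by auto
qed

lemma schwartz_continuous: "\<phi> \<in> schwartz \<Longrightarrow> continuous_on A \<phi>"
  by (meson DERIV_continuous_on has_field_derivative_at_within schwartz_DERIV)

lemma schwartz_measurable [measurable_dest]: "\<phi> \<in> schwartz \<Longrightarrow> \<phi> \<in> borel_measurable borel"
  by (simp add: borel_measurable_continuous_onI schwartz_continuous)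

lemma schwartz_linear_combination:
  assumes "\<phi> \<in> schwartz" "\<psi> \<in> schwartz"
  shows "(\<lambda>t. a * \<phi> t + b * \<psi> t) \<in> schwartz"
proof (rule schwartz_coinduct)
  let ?S = "{\<lambda>t. a * f t + b * g t | f g. f \<in> schwartz \<and> g \<in> schwartz}"
  show "(\<lambda>t. a * \<phi> t + b * \<psi> t) \<in> ?S" using assms by blast
  fix h assume "h \<in> ?S"
  then obtain f g where h: "h = (\<lambda>t. a * f t + b * g t)" and fg: "f \<in> schwartz" "g \<in> schwartz"
    by blast
  have d: "(h has_real_derivative a * deriv f t + b * deriv g t) (at t)" for t
    unfolding h by (auto intro!: derivative_eq_intros schwartz_DERIV fg)
  show "h differentiable at t" for t
    using d real_differentiable_def by blast
  have "deriv h = (\<lambda>t. a * deriv f t + b * deriv g t)"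
    using d DERIV_imp_deriv by blast
  then show "deriv h \<in> ?S" using fg schwartz_deriv by blast
  fix k
  obtain C where C: "\<And>t. \<bar>t ^ k * f t\<bar> \<le> C" using schwartz_bound[OF fg(1)] by blast
  obtain D where D: "\<And>t. \<bar>t ^ k * g t\<bar> \<le> D" using schwartz_bound[OF fg(2)] by blast
  have "\<bar>t ^ k * h t\<bar> \<le> \<bar>a\<bar> * C + \<bar>b\<bar> * D" for t
  proof -
    have "t ^ k * h t = a * (t ^ k * f t) + b * (t ^ k * g t)"
      unfolding h by (simp add: algebra_simps)
    also have "\<bar>\<dots>\<bar> \<le> \<bar>a\<bar> * \<bar>t ^ k * f t\<bar> + \<bar>b\<bar> * \<bar>t ^ k * g t\<bar>"
      using abs_triangle_ineq[of "a * (t ^ k * f t)" "b * (t ^ k * g t)"] by (simp only: abs_mult)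
    also have "\<dots> \<le> \<bar>a\<bar> * C + \<bar>b\<bar> * D"
      using C D by (intro add_mono mult_left_mono) auto
    finally show ?thesis .
  qed
  then show "\<exists>C. \<forall>t. \<bar>t ^ k * h t\<bar> \<le> C" by blast
qed

lemma schwartz_add: "\<phi> \<in> schwartz \<Longrightarrow> \<psi> \<in> schwartz \<Longrightarrow> (\<lambda>t. \<phi> t + \<psi> t) \<in> schwartz"
  using schwartz_linear_combination[of \<phi> \<psi> 1 1] by simp

lemma schwartz_diff: "\<phi> \<in> schwartz \<Longrightarrow> \<psi> \<in> schwartz \<Longrightarrow> (\<lambda>t. \<phi> t - \<psi> t) \<in> schwartz"
  using schwartz_linear_combination[of \<phi> \<psi> 1 "-1"] by simp

lemma schwartz_scale: "\<phi> \<in> schwartz \<Longrightarrow> (\<lambda>t. c * \<phi> t) \<in> schwartz"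
  using schwartz_linear_combination[of \<phi> \<phi> c 0] by simp

lemma deriv_add_schwartz:
  "\<phi> \<in> schwartz \<Longrightarrow> \<psi> \<in> schwartz \<Longrightarrow> deriv (\<lambda>t. \<phi> t + \<psi> t) = (\<lambda>t. deriv \<phi> t + deriv \<psi> t)"
  by (intro ext DERIV_imp_deriv derivative_intros schwartz_DERIV)

lemma deriv_scale_schwartz:
  "\<phi> \<in> schwartz \<Longrightarrow> deriv (\<lambda>t. c * \<phi> t) = (\<lambda>t. c * deriv \<phi> t)"
  by (rule ext, rule DERIV_imp_deriv) (auto intro!: derivative_eq_intros schwartz_DERIV)

section \<open>Decay and integrability of Schwartz functions\<close>

lemma integrable_inverse_square: "integrable lborel (\<lambda>t::real. 1 / (1 + t\<^sup>2))"
  using integrable_inverse_1_plus_square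
  by (simp add: set_integrable_def einterval_def inverse_eq_divide)

text \<open>The quantitative form serves twice: it makes moments of Schwartz functions integrable, and it
bounds the functional of an affine function by finitely many seminorms, which is continuity.\<close>

lemma integrable_of_decay:
  fixes f :: "real \<Rightarrow> real"
  assumes [measurable]: "f \<in> borel_measurable borel"
    and "\<And>t. \<bar>f t\<bar> \<le> C" "\<And>t. \<bar>t\<^sup>2 * f t\<bar> \<le> D"
  shows "integrable lborel f" "\<bar>LINT t|lborel. f t\<bar> \<le> (C + D) * (LINT t|lborel. 1 / (1 + t\<^sup>2))"
proof -
  have bound: "\<bar>f t\<bar> \<le> (C + D) * (1 / (1 + t\<^sup>2))" for t
  proof -
    have "\<bar>f t\<bar> * (1 + t\<^sup>2) = \<bar>f t\<bar> + \<bar>t\<^sup>2 * f t\<bar>"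
      by (simp add: algebra_simps abs_mult)
    then have "\<bar>f t\<bar> * (1 + t\<^sup>2) \<le> C + D" using assms(2,3)[of t] by linarith
    then show ?thesis by (simp add: pos_le_divide_eq add_pos_nonneg)
  qed
  have int: "integrable lborel (\<lambda>t. (C + D) * (1 / (1 + t\<^sup>2)))"
    by (intro integrable_mult_right integrable_inverse_square)
  show f: "integrable lborel f"
  proof (rule Bochner_Integration.integrable_bound[OF int])
    have "norm (f t) \<le> norm ((C + D) * (1 / (1 + t\<^sup>2)))" for t
      unfolding real_norm_def by (rule order_trans[OF bound abs_ge_self])
    then show "AE t in lborel. norm (f t) \<le> norm ((C + D) * (1 / (1 + t\<^sup>2)))" by simp
  qed simp
  have "\<bar>LINT t|lborel. f t\<bar> \<le> (LINT t|lborel. \<bar>f t\<bar>)" by simp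
  also have "\<dots> \<le> (LINT t|lborel. (C + D) * (1 / (1 + t\<^sup>2)))"
    by (intro integral_mono int integrable_abs f bound)
  finally show "\<bar>LINT t|lborel. f t\<bar> \<le> (C + D) * (LINT t|lborel. 1 / (1 + t\<^sup>2))"
    by (simp only: integral_mult_right_zero)
qed

lemma integrable_power_schwartz:
  assumes "\<phi> \<in> schwartz" shows "integrable lborel (\<lambda>t. t ^ k * \<phi> t)"
proof -
  obtain C where C: "\<And>t. \<bar>t ^ k * \<phi> t\<bar> \<le> C" using schwartz_bound[OF assms] by blast
  obtain D where D: "\<And>t. \<bar>t ^ (k + 2) * \<phi> t\<bar> \<le> D" using schwartz_bound[OF assms] by blast
  show ?thesis
  proof (rule integrable_of_decay(1))
    show "(\<lambda>t. t ^ k * \<phi> t) \<in> borel_measurable borel"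
      using assms by measurable
    show "\<bar>t ^ k * \<phi> t\<bar> \<le> C" for t by (rule C)
    have "t\<^sup>2 * (t ^ k * \<phi> t) = t ^ (k + 2) * \<phi> t" for t
      by (simp add: power_add mult.commute mult.left_commute power2_eq_square)
    then show "\<bar>t\<^sup>2 * (t ^ k * \<phi> t)\<bar> \<le> D" for t using D by metis
  qed
qed

lemma integrable_schwartz: "\<phi> \<in> schwartz \<Longrightarrow> integrable lborel \<phi>"
  using integrable_power_schwartz[of \<phi> 0] by simp

lemma integrable_id_schwartz: "\<phi> \<in> schwartz \<Longrightarrow> integrable lborel (\<lambda>t. t * \<phi> t)"
  using integrable_power_schwartz[of \<phi> 1] by simp

lemma power_schwartz_tendsto_0:
  assumes "\<phi> \<in> schwartz"
  shows "((\<lambda>t. t ^ k * \<phi> t) \<longlongrightarrow> 0) at_infinity"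
proof -
  obtain C where C: "\<And>t. \<bar>t ^ (k + 1) * \<phi> t\<bar> \<le> C" using schwartz_bound[OF assms] by blast
  have "((\<lambda>t::real. C / t) \<longlongrightarrow> 0) at_infinity"
    by (intro tendsto_divide_0[OF tendsto_const] filterlim_ident)
  moreover have "\<bar>t ^ k * \<phi> t\<bar> \<le> \<bar>C / t\<bar>" if "t \<noteq> 0" for t
  proof -
    have "\<bar>t\<bar> * \<bar>t ^ k * \<phi> t\<bar> \<le> \<bar>C\<bar>"
      using C[of t] by (simp add: abs_mult power_add mult_ac)
    then show ?thesis using that by (simp add: pos_le_divide_eq mult.commute)
  qed
  then have "\<forall>\<^sub>F t in at_infinity. norm (t ^ k * \<phi> t) \<le> norm (C / t)"
    unfolding eventually_at_infinity by (intro exI[of _ 1]) auto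
  ultimately show ?thesis
    by (rule Lim_null_comparison[OF _ tendsto_norm_zero, rotated])
qed

section \<open>Smooth windows of compact support\<close>

text \<open>With weight W = (x - a)(b - x), the functions p W^(-k) exp (-c/W) (p a polynomial), extended by
zero outside (a,b), form a family closed under differentiation: this is why the polynomial and the
exponent are parameters. The windows below are the case k = 0, p = 1.\<close>

definition bump :: "real \<Rightarrow> real \<Rightarrow> real \<Rightarrow> nat \<Rightarrow> real poly \<Rightarrow> real \<Rightarrow> real" where
  "bump c a b k p x =
     (if a < x \<and> x < b
      then poly p x / ((x - a) * (b - x)) ^ k * exp (- c / ((x - a) * (b - x))) else 0)"

lemma power_le_fact_exp: "s ^ n \<le> fact n * exp s" if "s \<ge> 0" for s :: real
proof -
  have "s ^ n /\<^sub>R fact n \<le> exp s"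
    using sum_le_suminf[OF summable_exp_generic[of s], of "{n}"] that by (simp add: exp_def)
  then show ?thesis by (simp add: field_simps)
qed

text \<open>The exponential beats every power of the weight W = (x-a)(b-x), because s^(k+2) \<le> (k+2)! exp s
at s = c/W. The surplus factor W^2 makes the derivative vanish wherever the function is continued
by zero, the endpoints included.\<close>

lemma bump_quadratic_bound:
  assumes "c > 0"
  obtains C where "C \<ge> 0" "\<And>x. \<bar>bump c a b k p x\<bar> \<le> C * ((x - a) * (b - x))\<^sup>2"
proof -
  have "bounded (poly p ` {a..b})"
    by (intro compact_imp_bounded compact_continuous_image continuous_intros) auto
  then obtain B where B: "\<And>x. x \<in> {a..b} \<Longrightarrow> \<bar>poly p x\<bar> \<le> B"
    unfolding bounded_iff by fastforce
  \<comment> \<open>B bounds the polynomial on [a, b], the other factor bounds W^(-(k+2)) exp (-c/W).\<close>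
  define C where "C = \<bar>B\<bar> * (fact (k + 2) / c ^ (k + 2))"
  have "C \<ge> 0" using assms by (simp add: C_def)
  have "\<bar>bump c a b k p x\<bar> \<le> C * ((x - a) * (b - x))\<^sup>2" for x
  proof (cases "a < x \<and> x < b")
    case True
    define w where "w = (x - a) * (b - x)"
    have w: "w > 0" using True by (simp add: w_def)
    have "(c / w) ^ (k + 2) \<le> fact (k + 2) * exp (c / w)"
      by (rule power_le_fact_exp) (use w assms in auto)
    then have "exp (- c / w) * (1 / w ^ (k + 2)) \<le> fact (k + 2) / c ^ (k + 2)"
      using w assms by (simp add: exp_minus power_divide field_simps del: power_Suc)
    then have "exp (- c / w) * (1 / w ^ (k + 2)) * w\<^sup>2 \<le> fact (k + 2) / c ^ (k + 2) * w\<^sup>2"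
      by (rule mult_right_mono) simp
    then have "exp (- c / w) * (1 / w ^ k) \<le> fact (k + 2) / c ^ (k + 2) * w\<^sup>2"
      using w by (simp add: power_add power2_eq_square)
    moreover have "\<bar>poly p x\<bar> \<le> \<bar>B\<bar>" using B[of x] True by force
    ultimately have "\<bar>poly p x\<bar> * (exp (- c / w) * (1 / w ^ k)) \<le> \<bar>B\<bar> * (fact (k + 2) / c ^ (k + 2) * w\<^sup>2)"
      using w assms by (intro mult_mono[of "\<bar>poly p x\<bar>"]) auto
    moreover have "bump c a b k p x = poly p x / w ^ k * exp (- c / w)"
      using True by (simp add: bump_def w_def)
    ultimately show ?thesis using w
      unfolding w_def[symmetric] by (simp add: abs_mult C_def mult_ac)
  qed (use \<open>C \<ge> 0\<close> in \<open>auto simp: bump_def\<close>)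
  with \<open>C \<ge> 0\<close> show ?thesis using that by blast
qed

lemma bump_has_derivative:
  fixes a b c :: real and p :: "real poly"
  assumes c: "c > 0"
  defines "W \<equiv> [:- a, 1:] * [:b, - 1:]" and "V \<equiv> [:a + b, - 2:]"
  shows "(bump c a b k p has_real_derivative
           bump c a b (k + 2) (pderiv p * W ^ 2 - [:real k:] * (p * W * V) + [:c:] * (p * V)) x) (at x)"
    (is "(_ has_real_derivative bump _ _ _ _ ?q x) _")
proof (cases "a < x \<and> x < b")
  case True
  define w where "w = (\<lambda>x. (x - a) * (b - x))"
  have w: "w x > 0" using True by (simp add: w_def)
  have w': "(w has_real_derivative (a + b - 2 * x)) (at x)"
    unfolding w_def by (auto intro!: derivative_eq_intros)
  have "((\<lambda>x. poly p x / w x ^ k * exp (- c / w x)) has_real_derivative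
      poly ?q x / w x ^ (k + 2) * exp (- c / w x)) (at x)"
  proof -
    have W: "poly W x = w x" by (simp add: W_def w_def algebra_simps)
    have "((\<lambda>x. w x ^ k) has_real_derivative real k * w x ^ (k - Suc 0) * (a + b - 2 * x)) (at x)"
      using DERIV_power[OF w', of k] by (simp add: mult_ac)
    moreover have "real k * w x ^ (k - Suc 0) = real k * w x ^ k / w x"
      using w by (cases k) auto
    ultimately have d1: "((\<lambda>x. w x ^ k) has_real_derivative real k * w x ^ k / w x * (a + b - 2 * x)) (at x)"
      by simp
    have d2: "((\<lambda>x. exp (- c / w x)) has_real_derivative exp (- c / w x) * (c * (a + b - 2 * x) / (w x)\<^sup>2)) (at x)"
      using w by (auto intro!: derivative_eq_intros w' simp: power2_eq_square)
    have "w x ^ k \<noteq> 0" using w by simp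
    note d = DERIV_mult[OF DERIV_divide[OF poly_DERIV[of p x] d1 this] d2]
    have alg: "(P' * K - P * (r * K / v * u)) / (K * K) * e + e * (c * u / v\<^sup>2) * (P / K)
      = (P' * v\<^sup>2 - r * (P * v * u) + c * (P * u)) / (K * v\<^sup>2) * e"
      if "K \<noteq> 0" "v \<noteq> 0" for P P' K r v u e :: real
      using that by (simp add: divide_simps) (simp add: algebra_simps power2_eq_square)
    show ?thesis
      by (rule DERIV_cong[OF d], subst alg)
        (use w in \<open>simp_all add: W V_def power_add algebra_simps power2_eq_square\<close>)
  qed
  then have "(bump c a b k p has_real_derivative
      poly ?q x / w x ^ (k + 2) * exp (- c / w x)) (at x)"
    by (rule has_field_derivative_transform_within_open[where S="{a<..<b}"])
      (use True in \<open>auto simp: bump_def w_def\<close>)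
  then show ?thesis using True by (simp add: bump_def w_def)
next
  case False
  obtain C where C: "C \<ge> 0" "\<And>x. \<bar>bump c a b k p x\<bar> \<le> C * ((x - a) * (b - x))\<^sup>2"
    using bump_quadratic_bound[OF c] by blast
  \<comment> \<open>One factor of the weight is at most the distance to x, the other one at most the length b - a.\<close>
  have b: "\<bar>bump c a b k p y\<bar> \<le> C * (b - a)\<^sup>2 * (y - x)\<^sup>2" for y
  proof (cases "a < y \<and> y < b")
    case True
    have "(y - a) * (b - y) \<le> (b - a) * \<bar>y - x\<bar>"
    proof (cases "x \<le> a")
      case le: True
      have "(y - a) * (b - y) \<le> \<bar>y - x\<bar> * (b - a)"
        using le True by (intro mult_mono) auto
      then show ?thesis by (simp add: mult.commute)
    next
      case False
      then show ?thesis using True \<open>\<not> (a < x \<and> x < b)\<close> by (intro mult_mono) auto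
    qed
    then have "((y - a) * (b - y))\<^sup>2 \<le> ((b - a) * \<bar>y - x\<bar>)\<^sup>2"
      using True by (intro power_mono) auto
    then have "C * ((y - a) * (b - y))\<^sup>2 \<le> C * ((b - a) * \<bar>y - x\<bar>)\<^sup>2"
      using C(1) by (intro mult_left_mono)
    then show ?thesis using C(2)[of y] by (simp add: power_mult_distrib mult.assoc)
  next
    case False
    then have "bump c a b k p y = 0" by (auto simp: bump_def)
    then show ?thesis using C(1) by simp
  qed
  have "((\<lambda>y. C * (b - a)\<^sup>2 * (y - x)) \<longlongrightarrow> 0) (at x)"
    by (auto intro!: tendsto_eq_intros)
  moreover have "norm ((bump c a b k p y - bump c a b k p x) / (y - x)) \<le> norm (C * (b - a)\<^sup>2 * (y - x))"
    for y
  proof (cases "y = x")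
    case False
    have "bump c a b k p x = 0" using \<open>\<not> (a < x \<and> x < b)\<close> by (auto simp: bump_def)
    then show ?thesis using b[of y] False C(1)
      by (simp add: abs_mult divide_simps power2_eq_square mult.assoc)
  qed simp
  then have "\<forall>\<^sub>F y in at x. norm ((bump c a b k p y - bump c a b k p x) / (y - x)) \<le> norm (C * (b - a)\<^sup>2 * (y - x))"
    by simp
  ultimately have "((\<lambda>y. (bump c a b k p y - bump c a b k p x) / (y - x)) \<longlongrightarrow> 0) (at x)"
    by (rule Lim_null_comparison[OF _ tendsto_norm_zero, rotated])
  then have "(bump c a b k p has_real_derivative 0) (at x)"
    by (simp add: has_field_derivative_iff)
  moreover have "bump c a b (k + 2) ?q x = 0" using False by (auto simp: bump_def)
  ultimately show ?thesis by simp
qed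

lemma bump_schwartz: assumes "c > 0" shows "bump c a b k p \<in> schwartz"
proof (rule schwartz_coinduct)
  let ?S = "{bump c a b k p | k p. True}"
  show "bump c a b k p \<in> ?S" by blast
  fix g assume "g \<in> ?S"
  then obtain k p where g: "g = bump c a b k p" by blast
  show "g differentiable at t" for t
    using bump_has_derivative[OF assms] real_differentiable_def g by blast
  show "deriv g \<in> ?S"
  proof -
    have "deriv g = bump c a b (k + 2) (pderiv p * ([:- a, 1:] * [:b, - 1:]) ^ 2
      - [:real k:] * (p * ([:- a, 1:] * [:b, - 1:]) * [:a + b, - 2:]) + [:c:] * (p * [:a + b, - 2:]))"
      unfolding g by (rule ext, rule DERIV_imp_deriv, rule bump_has_derivative[OF assms])
    then show ?thesis by blast
  qed
  fix j
  have "continuous_on UNIV g"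
    unfolding g by (intro continuous_at_imp_continuous_on ballI DERIV_isCont[OF bump_has_derivative[OF assms]])
  then have "compact ((\<lambda>t. t ^ j * g t) ` {a..b})"
    by (intro compact_continuous_image continuous_intros) (auto intro: continuous_on_subset)
  then have "bounded ((\<lambda>t. t ^ j * g t) ` {a..b})" by (rule compact_imp_bounded)
  then obtain B where B: "\<And>x. x \<in> {a..b} \<Longrightarrow> \<bar>x ^ j * g x\<bar> \<le> B"
    unfolding bounded_iff by (auto simp del: atLeastAtMost_iff)
  have "\<bar>t ^ j * g t\<bar> \<le> max B 0" for t
    using B[of t] by (cases "t \<in> {a..b}") (auto simp: g bump_def)
  then show "\<exists>C. \<forall>t. \<bar>t ^ j * g t\<bar> \<le> C" by blast
qed

text \<open>As c tends to 0 these windows increase to the indicator of the open interval (a,b), while staying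
positive exactly on it. The first property identifies measures, the second one identifies
continuous functions.\<close>

definition window :: "real \<Rightarrow> real \<Rightarrow> real \<Rightarrow> real \<Rightarrow> real" where
  "window c a b x = (if a < x \<and> x < b then exp (- c / ((x - a) * (b - x))) else 0)"

lemma window_schwartz: "c > 0 \<Longrightarrow> window c a b \<in> schwartz"
  using bump_schwartz[of c a b 0 1] by (simp add: bump_def[abs_def] window_def[abs_def] cong del: if_weak_cong)

lemma window_bounds: "0 \<le> window c a b x" "c > 0 \<Longrightarrow> window c a b x \<le> 1"
  "window c a b x > 0 \<longleftrightarrow> a < x \<and> x < b"
  by (auto simp: window_def)

lemma window_tendsto_indicator:
  "(\<lambda>n. window (1 / Suc n) a b x) \<longlonglongrightarrow> indicator {a<..<b} x"
proof (cases "a < x \<and> x < b")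
  case True
  have "(\<lambda>n. exp (- (1 / Suc n) / ((x - a) * (b - x)))) \<longlonglongrightarrow> exp (- 0 / ((x - a) * (b - x)))"
    by (intro tendsto_intros lim_1_over_n[THEN LIMSEQ_Suc]) (use True in auto)
  then show ?thesis using True by (simp add: window_def)
qed (auto simp: window_def)

section \<open>Schwartz functions separate finite measures\<close>

lemma finite_borel_measure_facts:
  assumes "finite_borel_measure \<mu>"
  shows "sets \<mu> = sets borel" "space \<mu> = UNIV" "finite_measure \<mu>"
proof -
  show "sets \<mu> = sets borel" "finite_measure \<mu>"
    using assms by (simp_all add: finite_borel_measure_def)
  then show "space \<mu> = UNIV" using sets_eq_imp_space_eq[of \<mu> borel] by simp
qed

lemma integrable_finite_borel:
  fixes f :: "real \<Rightarrow> real"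
  assumes "finite_borel_measure \<mu>" "f \<in> borel_measurable borel" "\<And>t. \<bar>f t\<bar> \<le> C"
  shows "integrable \<mu> f"
proof -
  interpret finite_measure \<mu> by (rule finite_borel_measure_facts) fact
  have "f \<in> borel_measurable \<mu>"
    using assms(2) measurable_cong_sets[OF finite_borel_measure_facts(1)[OF assms(1)] refl] by blast
  then show ?thesis by (intro integrable_const_bound[of _ C]) (use assms(3) in auto)
qed

lemma window_integral_tendsto:
  assumes "finite_borel_measure \<mu>"
  shows "(\<lambda>n. LINT t|\<mu>. window (1 / Suc n) a b t) \<longlonglongrightarrow> measure \<mu> {a<..<b}"
proof -
  interpret finite_measure \<mu> by (rule finite_borel_measure_facts) fact
  note s = finite_borel_measure_facts(1)[OF assms]
  have [measurable]: "window (1 / Suc n) a b \<in> borel_measurable \<mu>" for n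
    using schwartz_measurable[OF window_schwartz[of "1 / Suc n" a b]] measurable_cong_sets[OF s refl]
    by auto
  have [measurable]: "{a<..<b} \<in> sets \<mu>" using s by simp
  have "(\<lambda>n. LINT t|\<mu>. window (1 / Suc n) a b t) \<longlonglongrightarrow> (LINT t|\<mu>. indicator {a<..<b} t)"
  proof (rule integral_dominated_convergence[where w="\<lambda>_. 1"])
    show "AE t in \<mu>. (\<lambda>n. window (1 / Suc n) a b t) \<longlonglongrightarrow> indicator {a<..<b} t"
      by (rule AE_I2, rule window_tendsto_indicator)
    show "AE t in \<mu>. norm (window (1 / Suc n) a b t) \<le> 1" for n
      using window_bounds(1,2)[of "1 / Suc n" a b] by (intro AE_I2) simp
  qed (simp_all del: of_nat_Suc)
  then show ?thesis by (simp add: finite_borel_measure_facts(2)[OF assms])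
qed

lemma measure_symmetric_intervals_tendsto:
  assumes "finite_borel_measure \<mu>"
  shows "(\<lambda>n. measure \<mu> {- real n<..<real n}) \<longlonglongrightarrow> measure \<mu> UNIV"
proof -
  interpret finite_measure \<mu> by (rule finite_borel_measure_facts) fact
  have "(\<lambda>n. measure \<mu> {- real n<..<real n}) \<longlonglongrightarrow> measure \<mu> (\<Union>n. {- real n<..<real n})"
    by (intro finite_Lim_measure_incseq)
      (auto simp: incseq_def finite_borel_measure_facts(1)[OF assms])
  moreover have "x \<in> (\<Union>n. {- real n<..<real n})" for x
    using reals_Archimedean2[of "\<bar>x\<bar>"] by (auto simp: abs_less_iff minus_less_iff)
  then have "(\<Union>n. {- real n<..<real n}) = UNIV" by blast
  ultimately show ?thesis by simp
qed

text \<open>Windows converge boundedly to indicators of open intervals, so the two signed measures agree on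
those. Open intervals are stable under intersection and generate the Borel sets, and the
difference of the two set functions is countably additive, whence agreement everywhere. The
measures of the whole line, needed for complements, are obtained by exhaustion.\<close>

lemma signed_measure_eqI_schwartz:
  assumes fin: "finite_borel_measure P" "finite_borel_measure N"
      "finite_borel_measure P'" "finite_borel_measure N'"
    and eq: "\<And>\<phi>. \<phi> \<in> schwartz \<Longrightarrow>
      (LINT t|P. \<phi> t) - (LINT t|N. \<phi> t) = (LINT t|P'. \<phi> t) - (LINT t|N'. \<phi> t)"
    and A: "A \<in> sets borel"
  shows "measure P A - measure N A = measure P' A - measure N' A"
proof -
  interpret P: finite_measure P by (rule finite_borel_measure_facts) fact
  interpret N: finite_measure N by (rule finite_borel_measure_facts) fact
  interpret P': finite_measure P' by (rule finite_borel_measure_facts) fact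
  interpret N': finite_measure N' by (rule finite_borel_measure_facts) fact
  note s = fin[THEN finite_borel_measure_facts(1)] and sp = fin[THEN finite_borel_measure_facts(2)]
  let ?d = "\<lambda>A. measure P A - measure N A - (measure P' A - measure N' A)"
  have box: "?d {a<..<b} = 0" for a b
  proof -
    have "(\<lambda>n. (LINT t|P. window (1 / Suc n) a b t) - (LINT t|N. window (1 / Suc n) a b t)
        - ((LINT t|P'. window (1 / Suc n) a b t) - (LINT t|N'. window (1 / Suc n) a b t)))
      \<longlonglongrightarrow> ?d {a<..<b}"
      by (intro tendsto_diff window_integral_tendsto fin)
    moreover have "(LINT t|P. window (1 / Suc n) a b t) - (LINT t|N. window (1 / Suc n) a b t)
        - ((LINT t|P'. window (1 / Suc n) a b t) - (LINT t|N'. window (1 / Suc n) a b t)) = 0" for n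
      using eq[OF window_schwartz[of "1 / Suc n" a b]] by simp
    ultimately have "(\<lambda>n. 0 :: real) \<longlonglongrightarrow> ?d {a<..<b}" by simp
    then show ?thesis by (simp add: LIMSEQ_const_iff)
  qed
  have UN: "?d (\<Union>i. F i) = (\<Sum>i. ?d (F i)) \<and> summable (\<lambda>i. ?d (F i))"
    if F: "range F \<subseteq> sets borel" "disjoint_family F" for F :: "nat \<Rightarrow> real set"
  proof -
    have "(\<lambda>i. measure P (F i) - measure N (F i) - (measure P' (F i) - measure N' (F i))) sums ?d (\<Union>i. F i)"
      by (intro sums_diff P.finite_measure_UNION N.finite_measure_UNION
          P'.finite_measure_UNION N'.finite_measure_UNION) (use F s in auto)
    then show ?thesis by (simp add: sums_iff)
  qed
  have univ: "?d UNIV = 0"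
  proof -
    have "(\<lambda>n. ?d {- real n<..<real n}) \<longlonglongrightarrow> ?d UNIV"
      by (intro tendsto_diff measure_symmetric_intervals_tendsto fin)
    then show ?thesis by (simp only: box LIMSEQ_const_iff)
  qed
  let ?G = "range (\<lambda>(a, b). {a<..<b :: real})"
  have gen: "sets borel = sigma_sets UNIV ?G"
    by (subst borel_eq_box) (simp add: box_real case_prod_unfold)
  have "?d A = 0" if "A \<in> sigma_sets UNIV ?G" for A
  proof (rule sigma_sets_induct_disjoint[OF _ _ that])
    have "{a<..<b} \<inter> {c<..<d} = {max a c<..<min b d}" for a b c d :: real by auto
    then show "Int_stable ?G" by (auto simp: Int_stable_def)
    show "?G \<subseteq> Pow UNIV" by simp
    show "?d B = 0" if "B \<in> ?G" for B using that box by auto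
    show "?d {} = 0" by simp
    show "?d (UNIV - B) = 0" if "B \<in> sigma_sets UNIV ?G" "?d B = 0" for B
    proof -
      have B: "B \<in> sets borel" using that gen by simp
      have "measure P (UNIV - B) = measure P UNIV - measure P B"
        "measure N (UNIV - B) = measure N UNIV - measure N B"
        "measure P' (UNIV - B) = measure P' UNIV - measure P' B"
        "measure N' (UNIV - B) = measure N' UNIV - measure N' B"
        using P.finite_measure_compl[of B] N.finite_measure_compl[of B]
          P'.finite_measure_compl[of B] N'.finite_measure_compl[of B] B s sp by simp_all
      then show ?thesis using univ that(2) by simp
    qed
    show "?d (\<Union>i. F i) = 0" if "disjoint_family F" "range F \<subseteq> sigma_sets UNIV ?G"
      "\<And>i. ?d (F i) = 0" for F :: "nat \<Rightarrow> real set"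
      using UN[of F] that gen by simp
  qed
  then show ?thesis using A gen by simp
qed

text \<open>If h(x) \<noteq> 0, a window supported where h keeps its sign has a nonzero integral against h.\<close>

lemma continuous_eq_0_if_schwartz_integrals_vanish:
  assumes "continuous_on UNIV h" "\<And>\<phi>. \<phi> \<in> schwartz \<Longrightarrow> integrable lborel (\<lambda>t. h t * \<phi> t)"
    and "\<And>\<phi>. \<phi> \<in> schwartz \<Longrightarrow> (LINT t|lborel. h t * \<phi> t) = (0::real)"
  shows "h x = 0"
proof (rule ccontr)
  assume "h x \<noteq> 0"
  define s where "s = sgn (h x)"
  have "s * h x > 0" using \<open>h x \<noteq> 0\<close> by (simp add: s_def sgn_if)
  moreover have cont: "continuous_on UNIV (\<lambda>t. s * h t)"
    by (intro continuous_intros assms)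
  ultimately obtain d where d: "d > 0" "\<And>t. \<bar>t - x\<bar> < d \<Longrightarrow> s * h t > 0"
  proof -
    have "open {t. s * h t > 0}"
      using open_Collect_less[OF continuous_on_const cont] by simp
    then obtain d where "d > 0" "ball x d \<subseteq> {t. s * h t > 0}"
      using \<open>s * h x > 0\<close> open_contains_ball by blast
    then show thesis using that by (auto simp: subset_eq dist_real_def abs_minus_commute)
  qed
  define \<phi> where "\<phi> = window 1 (x - d) (x + d)"
  have \<phi>: "\<phi> \<in> schwartz" by (simp add: \<phi>_def window_schwartz)
  have pos: "0 \<le> s * (h t * \<phi> t)" for t
  proof (cases "\<bar>t - x\<bar> < d")
    case True
    then have "0 \<le> (s * h t) * \<phi> t"
      using d(2)[of t] by (intro mult_nonneg_nonneg[of "s * h t"]) (auto simp: \<phi>_def window_bounds)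
    then show ?thesis by (simp add: mult.assoc)
  next
    case False
    then have "\<phi> t = 0" by (auto simp: \<phi>_def window_def abs_less_iff)
    then show ?thesis by simp
  qed
  have int: "integrable lborel (\<lambda>t. s * (h t * \<phi> t))" using assms(2)[OF \<phi>] by simp
  have "(LINT t|lborel. s * (h t * \<phi> t)) = 0" using assms(3)[OF \<phi>] by simp
  then have "AE t in lborel. s * (h t * \<phi> t) = 0"
    using integral_nonneg_eq_0_iff_AE[OF int] pos by simp
  then have "AE t in lborel. t \<notin> {x - d<..<x + d}"
  proof (rule AE_mp, intro AE_I2 impI notI)
    fix t assume 0: "s * (h t * \<phi> t) = 0" and t: "t \<in> {x - d<..<x + d}"
    have "s * h t > 0" using t by (intro d) auto
    moreover have "\<phi> t > 0" using t by (simp add: \<phi>_def window_bounds)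
    ultimately show False using 0 by auto
  qed
  then have "emeasure lborel {x - d<..<x + d} = 0"
    by (subst (asm) AE_iff_measurable[of "{x - d<..<x + d}"]) auto
  then show False using d(1) by simp
qed

section \<open>Integration by parts and antiderivatives\<close>

lemma integral_derivative_greaterThan:
  fixes F f :: "real \<Rightarrow> real"
  assumes F: "\<And>t. (F has_real_derivative f t) (at t)" and cont: "continuous_on UNIV f"
    and int: "integrable lborel f" and top: "(F \<longlongrightarrow> 0) at_top"
  shows "(LINT t|lborel. indicator {\<tau><..} t * f t) = - F \<tau>"
proof -
  have "(LBINT t=ereal \<tau>..\<infinity>. f t) = 0 - F \<tau>"
  proof (rule interval_integral_FTC_integrable)
    show "(F has_vector_derivative f t) (at t)" for t
      using F by (simp add: has_real_derivative_iff_has_vector_derivative)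
    show "isCont f t" for t using cont by (simp add: continuous_on_eq_continuous_at)
    show "set_integrable lborel (einterval (ereal \<tau>) \<infinity>) f"
      unfolding set_integrable_def by (rule integrable_mult_indicator[OF _ int]) simp
    show "((F \<circ> real_of_ereal) \<longlongrightarrow> F \<tau>) (at_right (ereal \<tau>))"
      unfolding ereal_tendsto_simps
      using DERIV_isCont[OF F[of \<tau>]] unfolding isCont_def
      by (rule tendsto_mono[OF at_le[OF subset_UNIV]])
    show "((F \<circ> real_of_ereal) \<longlongrightarrow> 0) (at_left \<infinity>)"
      unfolding ereal_tendsto_simps by (rule top)
  qed simp
  then show ?thesis
    by (simp add: interval_lebesgue_integral_def set_lebesgue_integral_def einterval_def greaterThan_def)
qed

lemma integral_derivative_UNIV:
  fixes F f :: "real \<Rightarrow> real"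
  assumes F: "\<And>t. (F has_real_derivative f t) (at t)" and cont: "continuous_on UNIV f"
    and int: "integrable lborel f" and lim: "(F \<longlongrightarrow> 0) at_infinity"
  shows "(LINT t|lborel. f t) = 0"
proof -
  have "(LBINT t=-\<infinity>..\<infinity>. f t) = 0 - 0"
  proof (rule interval_integral_FTC_integrable)
    show "(F has_vector_derivative f t) (at t)" for t
      using F by (simp add: has_real_derivative_iff_has_vector_derivative)
    show "isCont f t" for t using cont by (simp add: continuous_on_eq_continuous_at)
    show "set_integrable lborel (einterval (-\<infinity>) \<infinity>) f"
      unfolding set_integrable_def by (rule integrable_mult_indicator[OF _ int]) simp
    show "((F \<circ> real_of_ereal) \<longlongrightarrow> 0) (at_right (-\<infinity>))"
      unfolding ereal_tendsto_simps
      by (rule filterlim_mono[OF lim order_refl at_bot_le_at_infinity])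
    show "((F \<circ> real_of_ereal) \<longlongrightarrow> 0) (at_left \<infinity>)"
      unfolding ereal_tendsto_simps
      by (rule filterlim_mono[OF lim order_refl at_top_le_at_infinity])
  qed simp
  then show ?thesis
    by (simp add: interval_lebesgue_integral_def set_lebesgue_integral_def einterval_def)
qed

lemma schwartz_tendsto_0: "\<phi> \<in> schwartz \<Longrightarrow> (\<phi> \<longlongrightarrow> 0) at_infinity"
  using power_schwartz_tendsto_0[of \<phi> 0] by simp

lemma id_schwartz_tendsto_0: "\<phi> \<in> schwartz \<Longrightarrow> ((\<lambda>t. t * \<phi> t) \<longlongrightarrow> 0) at_infinity"
  using power_schwartz_tendsto_0[of \<phi> 1] by simp

lemma integral_deriv_schwartz: "(LINT t|lborel. deriv \<phi> t) = 0" if "\<phi> \<in> schwartz"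
  by (rule integral_derivative_UNIV[of \<phi>])
    (use that in \<open>auto intro: schwartz_DERIV schwartz_continuous schwartz_deriv
      integrable_schwartz schwartz_tendsto_0\<close>)

lemma integral_id_deriv_schwartz:
  assumes "\<phi> \<in> schwartz" shows "(LINT t|lborel. t * deriv \<phi> t) = - (LINT t|lborel. \<phi> t)"
proof -
  note d = schwartz_deriv[OF assms]
  have "(LINT t|lborel. \<phi> t + t * deriv \<phi> t) = 0"
  proof (rule integral_derivative_UNIV[of "\<lambda>t. t * \<phi> t"])
    show "((\<lambda>t. t * \<phi> t) has_real_derivative \<phi> t + t * deriv \<phi> t) (at t)" for t
      by (auto intro!: derivative_eq_intros schwartz_DERIV assms)
    show "continuous_on UNIV (\<lambda>t. \<phi> t + t * deriv \<phi> t)"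
      by (intro continuous_intros schwartz_continuous assms d)
    show "integrable lborel (\<lambda>t. \<phi> t + t * deriv \<phi> t)"
      by (intro Bochner_Integration.integrable_add integrable_schwartz integrable_id_schwartz assms d)
    show "((\<lambda>t. t * \<phi> t) \<longlongrightarrow> 0) at_infinity" by (rule id_schwartz_tendsto_0) fact
  qed
  moreover have "(LINT t|lborel. \<phi> t + t * deriv \<phi> t) = (LINT t|lborel. \<phi> t) + (LINT t|lborel. t * deriv \<phi> t)"
    by (intro Bochner_Integration.integral_add integrable_schwartz integrable_id_schwartz assms d)
  ultimately show ?thesis by simp
qed

text \<open>The ramp t \<mapsto> (t - \<tau>)_+ is a fundamental solution of the second derivative. On
(\<tau>,\<infinity>) the integrand has the primitive (t - \<tau>)\<phi>'(t) - \<phi>(t), which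
equals -\<phi>(\<tau>) at the left end.\<close>

lemma integral_ramp_deriv2_schwartz:
  assumes "\<phi> \<in> schwartz"
  shows "integrable lborel (\<lambda>t. max 0 (t - \<tau>) * deriv (deriv \<phi>) t)"
    and "(LINT t|lborel. max 0 (t - \<tau>) * deriv (deriv \<phi>) t) = \<phi> \<tau>"
proof -
  note d = schwartz_deriv[OF assms] and dd = schwartz_deriv[OF schwartz_deriv[OF assms]]
  have eq: "max 0 (t - \<tau>) * deriv (deriv \<phi>) t
      = indicator {\<tau><..} t * (t * deriv (deriv \<phi>) t - \<tau> * deriv (deriv \<phi>) t)" for t
    by (auto simp: indicator_def max_def algebra_simps)
  have int: "integrable lborel (\<lambda>t. t * deriv (deriv \<phi>) t - \<tau> * deriv (deriv \<phi>) t)"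
    by (intro Bochner_Integration.integrable_diff integrable_mult_right integrable_schwartz
        integrable_id_schwartz dd)
  show "integrable lborel (\<lambda>t. max 0 (t - \<tau>) * deriv (deriv \<phi>) t)"
    unfolding eq using integrable_mult_indicator[OF _ int, of "{\<tau><..}"] by simp
  let ?F = "\<lambda>t. t * deriv \<phi> t - \<tau> * deriv \<phi> t - \<phi> t"
  have "(LINT t|lborel. max 0 (t - \<tau>) * deriv (deriv \<phi>) t) = - ?F \<tau>"
    unfolding eq
  proof (rule integral_derivative_greaterThan[of ?F, OF _ _ int])
    show "(?F has_real_derivative t * deriv (deriv \<phi>) t - \<tau> * deriv (deriv \<phi>) t) (at t)" for t
      by (auto intro!: derivative_eq_intros schwartz_DERIV assms d)
    show "continuous_on UNIV (\<lambda>t. t * deriv (deriv \<phi>) t - \<tau> * deriv (deriv \<phi>) t)"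
      by (intro continuous_intros schwartz_continuous dd)
    have "(?F \<longlongrightarrow> 0 - \<tau> * 0 - 0) at_infinity"
      by (intro tendsto_intros schwartz_tendsto_0 id_schwartz_tendsto_0 assms d)
    then show "(?F \<longlongrightarrow> 0) at_top"
      using tendsto_mono[OF at_top_le_at_infinity, of ?F 0] by simp
  qed
  then show "(LINT t|lborel. max 0 (t - \<tau>) * deriv (deriv \<phi>) t) = \<phi> \<tau>" by simp
qed

text \<open>The vanishing integral is what makes the primitive decay on both sides: it is the integral over
the left half-line, and equally minus the integral over the right one. On either of these
half-lines, taken on the side of t, |t|^k \<le> |s|^k, so t^k can be moved inside.\<close>

lemma schwartz_antiderivative:
  assumes \<psi>: "\<psi> \<in> schwartz" and zero: "(LINT t|lborel. \<psi> t) = 0"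
  obtains \<phi> where "\<phi> \<in> schwartz" "deriv \<phi> = \<psi>"
proof -
  define \<Phi> where "\<Phi> t = (LINT s|lborel. indicator {..t} s * \<psi> s)" for t
  note int = integrable_schwartz[OF \<psi>]
  have ind: "integrable lborel (\<lambda>s. indicator A s * \<psi> s)" if "A \<in> sets borel" for A
    using integrable_mult_indicator[OF _ int, of A] that by simp
  have cont: "isCont \<psi> t" for t
    using schwartz_continuous[OF \<psi>, of UNIV] by (simp add: continuous_on_eq_continuous_at)
  obtain G where G: "\<And>t. (G has_real_derivative \<psi> t) (at t)"
    using einterval_antiderivative[of "-\<infinity>" \<infinity> \<psi>] cont
    by (auto simp: has_real_derivative_iff_has_vector_derivative)
  \<comment> \<open>The improper integral differs from a pointwise primitive G by a constant.\<close>
  have step: "\<Phi> u - \<Phi> t = G u - G t" if "t \<le> u" for t u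
  proof -
    have "\<Phi> u - \<Phi> t = (LINT s|lborel. indicator {..u} s * \<psi> s - indicator {..t} s * \<psi> s)"
      unfolding \<Phi>_def by (rule Bochner_Integration.integral_diff[symmetric]) (auto intro: ind)
    also have "\<dots> = (LINT s|lborel. \<psi> s * indicator {t..u} s)"
    proof (rule integral_cong_AE)
      show "AE s in lborel. indicator {..u} s * \<psi> s - indicator {..t} s * \<psi> s = \<psi> s * indicator {t..u} s"
        using AE_lborel_singleton[of t] by eventually_elim (use that in \<open>auto simp: indicator_def\<close>)
    qed (use schwartz_measurable[OF \<psi>] in auto)
    also have "\<dots> = G u - G t"
      by (rule integral_FTC_Icc_real) (use that G cont in auto)
    finally show ?thesis .
  qed
  have "\<Phi> u = G u + (\<Phi> 0 - G 0)" for u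
    using step[of 0 u] step[of u 0] by linarith
  then have "\<Phi> = (\<lambda>u. G u + (\<Phi> 0 - G 0))" by blast
  moreover have "((\<lambda>u. G u + (\<Phi> 0 - G 0)) has_real_derivative \<psi> t) (at t)" for t
    by (auto intro!: derivative_eq_intros G)
  ultimately have D: "(\<Phi> has_real_derivative \<psi> t) (at t)" for t by metis
  then have D': "deriv \<Phi> = \<psi>" using DERIV_imp_deriv by blast
  have "\<Phi> \<in> schwartz"
  proof (rule schwartz_coinduct)
    show "\<Phi> \<in> insert \<Phi> schwartz" by simp
    fix f assume f: "f \<in> insert \<Phi> schwartz"
    show "deriv f \<in> insert \<Phi> schwartz" using f D' \<psi> schwartz_deriv by auto
    show "f differentiable at t" for t
      using f D schwartz_DERIV real_differentiable_def by blast
    fix k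
    have "\<bar>t ^ k * \<Phi> t\<bar> \<le> (LINT s|lborel. \<bar>s ^ k * \<psi> s\<bar>)" for t
    proof -
      have *: "\<bar>t ^ k * (LINT s|lborel. indicator A s * \<psi> s)\<bar> \<le> (LINT s|lborel. \<bar>s ^ k * \<psi> s\<bar>)"
        if A: "A \<in> sets borel" "\<And>s. s \<in> A \<Longrightarrow> \<bar>t\<bar> \<le> \<bar>s\<bar>" for A
      proof -
        have "\<bar>t ^ k * (LINT s|lborel. indicator A s * \<psi> s)\<bar>
            = \<bar>LINT s|lborel. t ^ k * (indicator A s * \<psi> s)\<bar>" by simp
        also have "\<dots> \<le> (LINT s|lborel. \<bar>t ^ k * (indicator A s * \<psi> s)\<bar>)"
          by (rule integral_abs_bound)
        also have "\<dots> \<le> (LINT s|lborel. \<bar>s ^ k * \<psi> s\<bar>)"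
        proof (rule integral_mono)
          show "integrable lborel (\<lambda>s. \<bar>t ^ k * (indicator A s * \<psi> s)\<bar>)"
            by (intro integrable_abs integrable_mult_right ind A)
          show "integrable lborel (\<lambda>s. \<bar>s ^ k * \<psi> s\<bar>)"
            by (intro integrable_abs integrable_power_schwartz \<psi>)
          show "\<bar>t ^ k * (indicator A s * \<psi> s)\<bar> \<le> \<bar>s ^ k * \<psi> s\<bar>" for s
            using A(2)[of s] by (cases "s \<in> A")
              (auto simp: abs_mult power_abs intro!: mult_right_mono power_mono)
        qed
        finally show ?thesis .
      qed
      show ?thesis
      proof (cases "t \<le> 0")
        case True
        then show ?thesis unfolding \<Phi>_def by (intro *) auto
      next
        case False
        have "\<Phi> t + (LINT s|lborel. indicator {t<..} s * \<psi> s)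
            = (LINT s|lborel. indicator {..t} s * \<psi> s + indicator {t<..} s * \<psi> s)"
          unfolding \<Phi>_def by (rule Bochner_Integration.integral_add[symmetric]) (auto intro: ind)
        also have "\<dots> = (LINT s|lborel. \<psi> s)"
          by (intro Bochner_Integration.integral_cong) (auto simp: indicator_def)
        finally have "\<Phi> t = - (LINT s|lborel. indicator {t<..} s * \<psi> s)" using zero by simp
        moreover have "\<bar>t ^ k * (LINT s|lborel. indicator {t<..} s * \<psi> s)\<bar> \<le> (LINT s|lborel. \<bar>s ^ k * \<psi> s\<bar>)"
          using False by (intro *) auto
        ultimately show ?thesis by simp
      qed
    qed
    then show "\<exists>C. \<forall>t. \<bar>t ^ k * f t\<bar> \<le> C"
      using f schwartz_bound by blast
  qed
  then show ?thesis using that D' by blast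
qed

section \<open>Linear functionals that vanish on derivatives\<close>

definition schwartz_linear :: "functional \<Rightarrow> bool" where
  "schwartz_linear T \<longleftrightarrow>
     (\<forall>\<phi>\<in>schwartz. \<forall>\<psi>\<in>schwartz. T (\<lambda>t. \<phi> t + \<psi> t) = T \<phi> + T \<psi>) \<and>
     (\<forall>c. \<forall>\<phi>\<in>schwartz. T (\<lambda>t. c * \<phi> t) = c * T \<phi>)"

text \<open>Subtracting from \<psi> the multiple of a fixed window with the same integral leaves a function of
integral zero, that is, a derivative. So T \<psi> depends on the integral of \<psi> only.\<close>

lemma schwartz_linear_vanishing_on_deriv:
  assumes lin: "schwartz_linear T" and van: "\<And>\<phi>. \<phi> \<in> schwartz \<Longrightarrow> T (deriv \<phi>) = 0"
  obtains a where "\<And>\<psi>. \<psi> \<in> schwartz \<Longrightarrow> T \<psi> = a * (LINT t|lborel. \<psi> t)"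
proof -
  define w where "w = window 1 0 1"
  have w: "w \<in> schwartz" by (simp add: w_def window_schwartz)
  define m where "m = (LINT t|lborel. w t)"
  have "m \<noteq> 0"
  proof
    assume "m = 0"
    then have "AE t in lborel. w t = 0"
      using integral_nonneg_eq_0_iff_AE[OF integrable_schwartz[OF w]]
      by (simp add: m_def w_def window_bounds)
    then have "AE t in lborel. t \<notin> {0<..<1::real}"
      by eventually_elim (auto simp: w_def window_def)
    then have "emeasure lborel {0<..<1::real} = 0"
      by (subst (asm) AE_iff_measurable[of "{0<..<1}"]) auto
    then show False by simp
  qed
  have "T \<psi> = T w / m * (LINT t|lborel. \<psi> t)" if \<psi>: "\<psi> \<in> schwartz" for \<psi>
  proof -
    define c where "c = - ((LINT t|lborel. \<psi> t) / m)"
    have "(LINT t|lborel. \<psi> t + c * w t) = (LINT t|lborel. \<psi> t) + c * m"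
      unfolding m_def using integrable_schwartz[OF \<psi>] integrable_schwartz[OF w] by simp
    also have "\<dots> = 0" using \<open>m \<noteq> 0\<close> by (simp add: c_def)
    finally obtain \<phi> where "\<phi> \<in> schwartz" "deriv \<phi> = (\<lambda>t. \<psi> t + c * w t)"
      using schwartz_antiderivative[OF schwartz_add[OF \<psi> schwartz_scale[OF w]]] by blast
    then have "0 = T (\<lambda>t. \<psi> t + c * w t)" using van by metis
    also have "\<dots> = T \<psi> + c * T w"
      using lin \<psi> w schwartz_scale[OF w] by (simp add: schwartz_linear_def)
    finally show ?thesis by (simp add: c_def)
  qed
  then show ?thesis using that by blast
qed

text \<open>The preceding lemma applied to \<phi> \<mapsto> T\<phi>' gives T\<phi>' = c \<integral>\<phi> =
-c\<integral> t \<phi>'(t) dt; hence \<phi> \<mapsto> T\<phi> + c\<integral> t \<phi>(t) dt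
vanishes on derivatives, and the lemma applies again.\<close>

lemma schwartz_linear_vanishing_on_deriv2:
  assumes lin: "schwartz_linear T"
    and van: "\<And>\<phi>. \<phi> \<in> schwartz \<Longrightarrow> T (deriv (deriv \<phi>)) = 0"
  obtains a b where "\<And>\<psi>. \<psi> \<in> schwartz \<Longrightarrow> T \<psi> = (LINT t|lborel. (a + b * t) * \<psi> t)"
proof -
  have "schwartz_linear (\<lambda>\<phi>. T (deriv \<phi>))"
    using lin by (simp add: schwartz_linear_def deriv_add_schwartz deriv_scale_schwartz schwartz_deriv)
  from schwartz_linear_vanishing_on_deriv[OF this van]
  obtain c where c: "\<And>\<psi>. \<psi> \<in> schwartz \<Longrightarrow> T (deriv \<psi>) = c * (LINT t|lborel. \<psi> t)" by blast
  have "(LINT t|lborel. t * (\<phi> t + \<psi> t)) = (LINT t|lborel. t * \<phi> t) + (LINT t|lborel. t * \<psi> t)"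
    if "\<phi> \<in> schwartz" "\<psi> \<in> schwartz" for \<phi> \<psi>
    using that[THEN integrable_id_schwartz] by (simp add: distrib_left)
  moreover have "(LINT t|lborel. t * (k * \<phi> t)) = k * (LINT t|lborel. t * \<phi> t)" for k :: real and \<phi>
    by (simp add: mult.left_commute[of _ k])
  ultimately have "schwartz_linear (\<lambda>\<phi>. T \<phi> + c * (LINT t|lborel. t * \<phi> t))"
    using lin by (simp add: schwartz_linear_def distrib_left mult.left_commute)
  moreover have "T (deriv \<phi>) + c * (LINT t|lborel. t * deriv \<phi> t) = 0" if "\<phi> \<in> schwartz" for \<phi>
    using c[OF that] integral_id_deriv_schwartz[OF that] by simp
  ultimately obtain a where
    a: "\<And>\<psi>. \<psi> \<in> schwartz \<Longrightarrow> T \<psi> + c * (LINT t|lborel. t * \<psi> t) = a * (LINT t|lborel. \<psi> t)"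
    using schwartz_linear_vanishing_on_deriv by blast
  have "T \<psi> = (LINT t|lborel. (a + (- c) * t) * \<psi> t)" if "\<psi> \<in> schwartz" for \<psi>
  proof -
    have "(LINT t|lborel. (a + (- c) * t) * \<psi> t) = (LINT t|lborel. a * \<psi> t - c * (t * \<psi> t))"
      by (simp add: algebra_simps)
    also have "\<dots> = a * (LINT t|lborel. \<psi> t) - c * (LINT t|lborel. t * \<psi> t)"
      using integrable_schwartz[OF that] integrable_id_schwartz[OF that] by simp
    finally show ?thesis using a[OF that] by simp
  qed
  then show ?thesis using that by blast
qed

section \<open>The potential of a finite measure\<close>

text \<open>Subtracting (-\<tau>)_+ from the ramp changes it by a constant in t, which the second derivative
kills, and bounds it by |t| uniformly in \<tau>. The potential of a finite measure therefore
exists although the measure may have no moments.\<close>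

definition green :: "real \<Rightarrow> real \<Rightarrow> real" where
  "green t \<tau> = max 0 (t - \<tau>) - max 0 (- \<tau>)"

definition potential :: "real measure \<Rightarrow> real \<Rightarrow> real" where
  "potential \<mu> t = (LINT \<tau>|\<mu>. green t \<tau>)"

lemma green_lipschitz: "\<bar>green t \<tau> - green t' \<tau>\<bar> \<le> \<bar>t - t'\<bar>"
  by (auto simp: green_def max_def)

lemma green_bound: "\<bar>green t \<tau>\<bar> \<le> \<bar>t\<bar>"
  using green_lipschitz[of t \<tau> 0] by (simp add: green_def)

lemma green_measurable: "green t \<in> borel_measurable borel"
  unfolding green_def by (intro borel_measurable_continuous_onI continuous_intros)

lemma integrable_green: "finite_borel_measure \<mu> \<Longrightarrow> integrable \<mu> (green t)"
  by (rule integrable_finite_borel[OF _ green_measurable green_bound])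

lemma potential_lipschitz:
  assumes "finite_borel_measure \<mu>"
  shows "\<bar>potential \<mu> t - potential \<mu> t'\<bar> \<le> \<bar>t - t'\<bar> * measure \<mu> UNIV"
proof -
  interpret finite_measure \<mu> by (rule finite_borel_measure_facts) fact
  have "\<bar>potential \<mu> t - potential \<mu> t'\<bar> = \<bar>LINT \<tau>|\<mu>. green t \<tau> - green t' \<tau>\<bar>"
    using integrable_green[OF assms] by (simp add: potential_def)
  also have "\<dots> \<le> (LINT \<tau>|\<mu>. \<bar>green t \<tau> - green t' \<tau>\<bar>)" by (rule integral_abs_bound)
  also have "\<dots> \<le> (LINT \<tau>|\<mu>. \<bar>t - t'\<bar>)"
    using integrable_green[OF assms] by (intro integral_mono green_lipschitz) auto
  also have "\<dots> = \<bar>t - t'\<bar> * measure \<mu> UNIV"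
    using finite_borel_measure_facts(2)[OF assms] by simp
  finally show ?thesis .
qed

lemma potential_bound:
  "finite_borel_measure \<mu> \<Longrightarrow> \<bar>potential \<mu> t\<bar> \<le> \<bar>t\<bar> * measure \<mu> UNIV"
  using potential_lipschitz[of \<mu> t 0] by (simp add: potential_def green_def)

lemma potential_continuous:
  assumes "finite_borel_measure \<mu>" shows "continuous_on A (potential \<mu>)"
proof -
  have "(measure \<mu> UNIV)-lipschitz_on A (potential \<mu>)"
    by (rule lipschitz_onI)
      (use potential_lipschitz[OF assms] in \<open>auto simp: dist_real_def mult.commute\<close>)
  then show ?thesis by (rule lipschitz_on_continuous_on)
qed

lemma integrable_linear_growth_schwartz:
  assumes "continuous_on UNIV g" "\<And>t. \<bar>g t\<bar> \<le> A + B * \<bar>t\<bar>" "\<phi> \<in> schwartz"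
  shows "integrable lborel (\<lambda>t. g t * \<phi> t)"
proof (rule Bochner_Integration.integrable_bound)
  show "integrable lborel (\<lambda>t. A * \<bar>\<phi> t\<bar> + B * \<bar>t * \<phi> t\<bar>)"
    by (intro Bochner_Integration.integrable_add integrable_mult_right integrable_abs
        integrable_schwartz integrable_id_schwartz assms)
  have [measurable]: "g \<in> borel_measurable borel"
    using assms(1) by (rule borel_measurable_continuous_onI)
  show "(\<lambda>t. g t * \<phi> t) \<in> borel_measurable lborel"
    using schwartz_measurable[OF assms(3)] by simp
  have "norm (g t * \<phi> t) \<le> norm (A * \<bar>\<phi> t\<bar> + B * \<bar>t * \<phi> t\<bar>)" for t
  proof -
    have "\<bar>g t * \<phi> t\<bar> \<le> (A + B * \<bar>t\<bar>) * \<bar>\<phi> t\<bar>"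
      using assms(2)[of t] by (simp add: abs_mult mult_right_mono)
    also have "\<dots> = A * \<bar>\<phi> t\<bar> + B * \<bar>t * \<phi> t\<bar>" by (simp add: abs_mult algebra_simps)
    finally show ?thesis by simp
  qed
  then show "AE t in lborel. norm (g t * \<phi> t) \<le> norm (A * \<bar>\<phi> t\<bar> + B * \<bar>t * \<phi> t\<bar>)" by simp
qed

text \<open>The second distributional derivative of the potential of \<mu> is \<mu>: exchange the two
integrations and use that the kernel is a fundamental solution. The exchange is justified by the
bound |t| on the kernel and by the decay of \<phi>''.\<close>

lemma integral_potential_deriv2:
  assumes \<mu>: "finite_borel_measure \<mu>" and \<phi>: "\<phi> \<in> schwartz"
  shows "(LINT t|lborel. potential \<mu> t * deriv (deriv \<phi>) t) = (LINT \<tau>|\<mu>. \<phi> \<tau>)"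
proof -
  interpret finite_measure \<mu> by (rule finite_borel_measure_facts) fact
  interpret pair_sigma_finite lborel \<mu> ..
  note s[measurable_cong] = finite_borel_measure_facts(1)[OF \<mu>]
  define h where "h = deriv (deriv \<phi>)"
  have h: "h \<in> schwartz" unfolding h_def by (intro schwartz_deriv \<phi>)
  have [measurable]: "h \<in> borel_measurable borel" by (rule schwartz_measurable[OF h])
  let ?f = "\<lambda>t \<tau>. green t \<tau> * h t"
  have meas[measurable]: "case_prod ?f \<in> borel_measurable (lborel \<Otimes>\<^sub>M \<mu>)"
    unfolding green_def by measurable
  have bound: "\<bar>LINT \<tau>|\<mu>. \<bar>green t \<tau> * h t\<bar>\<bar> \<le> measure \<mu> UNIV * \<bar>t * h t\<bar>" for t
  proof -
    have "\<bar>LINT \<tau>|\<mu>. \<bar>green t \<tau> * h t\<bar>\<bar> = (LINT \<tau>|\<mu>. \<bar>green t \<tau> * h t\<bar>)"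
      by simp
    also have "\<dots> \<le> (LINT \<tau>|\<mu>. \<bar>t * h t\<bar>)"
      using integrable_green[OF \<mu>]
      by (intro integral_mono integrable_abs integrable_mult_left)
        (auto simp: abs_mult intro!: mult_right_mono green_bound)
    also have "\<dots> = measure \<mu> UNIV * \<bar>t * h t\<bar>"
      using finite_borel_measure_facts(2)[OF \<mu>] by simp
    finally show ?thesis .
  qed
  have int: "integrable (lborel \<Otimes>\<^sub>M \<mu>) (case_prod ?f)"
  proof (rule Fubini_integrable[OF meas])
    show "integrable lborel (\<lambda>t. LINT \<tau>|\<mu>. norm (case (t, \<tau>) of (t, \<tau>) \<Rightarrow> green t \<tau> * h t))"
    proof (rule Bochner_Integration.integrable_bound)
      show "integrable lborel (\<lambda>t. measure \<mu> UNIV * \<bar>t * h t\<bar>)"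
        by (intro integrable_mult_right integrable_abs integrable_id_schwartz h)
      show "(\<lambda>t. LINT \<tau>|\<mu>. norm (case (t, \<tau>) of (t, \<tau>) \<Rightarrow> green t \<tau> * h t)) \<in> borel_measurable lborel"
        by measurable
      show "AE t in lborel. norm (LINT \<tau>|\<mu>. norm (case (t, \<tau>) of (t, \<tau>) \<Rightarrow> green t \<tau> * h t))
          \<le> norm (measure \<mu> UNIV * \<bar>t * h t\<bar>)"
        using bound by (intro AE_I2) (simp add: abs_mult)
    qed
    show "AE t in lborel. integrable \<mu> (\<lambda>\<tau>. case (t, \<tau>) of (t, \<tau>) \<Rightarrow> green t \<tau> * h t)"
      using integrable_green[OF \<mu>] by simp
  qed
  have inner: "(LINT t|lborel. green t \<tau> * h t) = \<phi> \<tau>" for \<tau>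
  proof -
    have "(LINT t|lborel. green t \<tau> * h t)
        = (LINT t|lborel. max 0 (t - \<tau>) * h t - max 0 (- \<tau>) * h t)"
      by (simp add: green_def algebra_simps)
    also have "\<dots> = (LINT t|lborel. max 0 (t - \<tau>) * h t) - max 0 (- \<tau>) * (LINT t|lborel. h t)"
      using integral_ramp_deriv2_schwartz(1)[OF \<phi>] integrable_schwartz[OF h] by (simp add: h_def)
    also have "\<dots> = \<phi> \<tau>"
      using integral_ramp_deriv2_schwartz(2)[OF \<phi>] integral_deriv_schwartz[OF schwartz_deriv[OF \<phi>]]
      by (simp add: h_def)
    finally show ?thesis .
  qed
  have "(LINT t|lborel. potential \<mu> t * h t) = (LINT t|lborel. LINT \<tau>|\<mu>. green t \<tau> * h t)"
    by (simp add: potential_def)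
  also have "\<dots> = (LINT \<tau>|\<mu>. LINT t|lborel. green t \<tau> * h t)"
    by (rule Fubini_integral[symmetric, OF int])
  finally show ?thesis unfolding h_def[symmetric] by (simp only: inner)
qed

section \<open>Elements of BV2 and their second derivatives\<close>

lemma D2_apply: "\<phi> \<in> schwartz \<Longrightarrow> D2 T \<phi> = T (deriv (deriv \<phi>))"
  by (simp add: D2_def distributional_deriv_def schwartz_deriv)

text \<open>Makes the definite description in the norm of a measure denote the measure at hand.\<close>

lemma represented_by_measure_unique:
  assumes "represented_by_measure S \<nu>" "represented_by_measure S \<nu>'"
  shows "\<nu> = \<nu>'"
proof -
  obtain P N where PN: "signed_decomposition \<nu> P N"
    "\<And>\<phi>. \<phi> \<in> schwartz \<Longrightarrow> S \<phi> = (LINT t|P. \<phi> t) - (LINT t|N. \<phi> t)"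
    using assms(1) unfolding represented_by_measure_def by blast
  obtain P' N' where PN': "signed_decomposition \<nu>' P' N'"
    "\<And>\<phi>. \<phi> \<in> schwartz \<Longrightarrow> S \<phi> = (LINT t|P'. \<phi> t) - (LINT t|N'. \<phi> t)"
    using assms(2) unfolding represented_by_measure_def by blast
  have "measure P A - measure N A = measure P' A - measure N' A" if "A \<in> sets borel" for A
  proof (rule signed_measure_eqI_schwartz[OF _ _ _ _ _ that])
    show "finite_borel_measure P" "finite_borel_measure N" "finite_borel_measure P'" "finite_borel_measure N'"
      using PN(1) PN'(1) by (auto simp: signed_decomposition_def)
  qed (use PN(2) PN'(2) in metis)
  then show ?thesis
    using PN(1) PN'(1) by (auto simp: signed_decomposition_def restrict_def fun_eq_iff)
qed

lemma measure_norm_eq: "represented_by_measure S \<nu> \<Longrightarrow> measure_norm S = total_variation \<nu>"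
  unfolding measure_norm_def
  by (rule arg_cong[of _ _ total_variation], rule the_equality)
    (auto intro: represented_by_measure_unique)

lemma continuous_representative_unique:
  assumes "continuous_representative T g" "continuous_representative T h"
  shows "g = h"
proof
  fix x
  have "g x - h x = 0"
  proof (rule continuous_eq_0_if_schwartz_integrals_vanish[of "\<lambda>t. g t - h t"])
    show "continuous_on UNIV (\<lambda>t. g t - h t)"
      using assms by (intro continuous_intros) (auto simp: continuous_representative_def)
    fix \<phi> :: "real \<Rightarrow> real" assume \<phi>: "\<phi> \<in> schwartz"
    have int: "integrable lborel (\<lambda>t. g t * \<phi> t)" "integrable lborel (\<lambda>t. h t * \<phi> t)"
      using assms \<phi> by (auto simp: continuous_representative_def)
    then show "integrable lborel (\<lambda>t. (g t - h t) * \<phi> t)" by (simp add: left_diff_distrib)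
    have "distribution_of g \<phi> = distribution_of h \<phi>"
      using assms by (simp add: continuous_representative_def)
    then show "(LINT t|lborel. (g t - h t) * \<phi> t) = 0"
      using int \<phi> by (simp add: left_diff_distrib distribution_of_def)
  qed
  then show "g x = h x" by simp
qed

lemma point_value_eq: "continuous_representative T g \<Longrightarrow> point_value T = g"
  unfolding point_value_def by (rule the_equality) (auto intro: continuous_representative_unique)

lemma tempered_schwartz_linear: "T \<in> tempered_distributions \<Longrightarrow> schwartz_linear T"
  by (simp add: tempered_distributions_def schwartz_linear_def)

lemma continuous_representativeI:
  assumes T: "T \<in> tempered_distributions" and cont: "continuous_on UNIV g"
    and growth: "\<And>t. \<bar>g t\<bar> \<le> A + B * \<bar>t\<bar>"
    and eq: "\<And>\<phi>. \<phi> \<in> schwartz \<Longrightarrow> T \<phi> = (LINT t|lborel. g t * \<phi> t)"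
  shows "continuous_representative T g"
  unfolding continuous_representative_def
proof (intro conjI ballI)
  show "T = distribution_of g"
  proof (rule extensionalityI[of _ schwartz])
    show "T \<in> extensional schwartz" using T by (simp add: tempered_distributions_def)
    show "distribution_of g \<in> extensional schwartz" by (simp add: distribution_of_def)
    show "T \<phi> = distribution_of g \<phi>" if "\<phi> \<in> schwartz" for \<phi>
      using eq[OF that] that by (simp add: distribution_of_def)
  qed
qed (use cont integrable_linear_growth_schwartz[OF cont growth] in auto)

text \<open>Subtracting the potential of its second derivative leaves a linear functional that vanishes on all
second derivatives, hence an affine function. Consequently point values of elements of BV2 are
those of an explicit formula.\<close>

lemma BV2_continuous_representative:
  assumes T: "T \<in> tempered_distributions" and D2: "represented_by_measure (D2 T) \<nu>"
  obtains P N a b where "signed_decomposition \<nu> P N"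
    and "continuous_representative T (\<lambda>t. a + b * t + (potential P t - potential N t))"
proof -
  obtain P N where dec: "signed_decomposition \<nu> P N"
    and rep: "\<And>\<phi>. \<phi> \<in> schwartz \<Longrightarrow> D2 T \<phi> = (LINT t|P. \<phi> t) - (LINT t|N. \<phi> t)"
    using D2 unfolding represented_by_measure_def by blast
  have fin: "finite_borel_measure P" "finite_borel_measure N"
    using dec by (auto simp: signed_decomposition_def)
  define q where "q t = potential P t - potential N t" for t
  have q_cont: "continuous_on UNIV q"
    unfolding q_def by (intro continuous_intros potential_continuous fin)
  define C where "C = measure P UNIV + measure N UNIV"
  have q_bound: "\<bar>q t\<bar> \<le> C * \<bar>t\<bar>" for t
    using potential_bound[OF fin(1), of t] potential_bound[OF fin(2), of t]
    unfolding q_def C_def by (simp add: algebra_simps)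
  have pot_int: "integrable lborel (\<lambda>t. potential \<mu> t * \<phi> t)"
    if "finite_borel_measure \<mu>" "\<phi> \<in> schwartz" for \<mu> \<phi>
    using potential_bound[OF that(1)]
    by (intro integrable_linear_growth_schwartz[of _ 0 "measure \<mu> UNIV"] potential_continuous that)
      (simp add: mult.commute)
  have q_int: "integrable lborel (\<lambda>t. q t * \<phi> t)" if "\<phi> \<in> schwartz" for \<phi>
    using q_bound by (intro integrable_linear_growth_schwartz[of _ 0 C] q_cont that) simp
  let ?S = "\<lambda>\<phi>. T \<phi> - (LINT t|lborel. q t * \<phi> t)"
  have "(LINT t|lborel. q t * (\<phi> t + \<psi> t)) = (LINT t|lborel. q t * \<phi> t) + (LINT t|lborel. q t * \<psi> t)"
    if "\<phi> \<in> schwartz" "\<psi> \<in> schwartz" for \<phi> \<psi>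
    using that[THEN q_int] by (simp add: distrib_left)
  moreover have "(LINT t|lborel. q t * (k * \<phi> t)) = k * (LINT t|lborel. q t * \<phi> t)" for k :: real and \<phi>
    by (simp add: mult.left_commute[of _ k])
  ultimately have lin: "schwartz_linear ?S"
    using tempered_schwartz_linear[OF T] by (simp add: schwartz_linear_def right_diff_distrib)
  have van: "?S (deriv (deriv \<phi>)) = 0" if \<phi>: "\<phi> \<in> schwartz" for \<phi>
  proof -
    have "(LINT t|lborel. q t * deriv (deriv \<phi>) t)
        = (LINT t|lborel. potential P t * deriv (deriv \<phi>) t) - (LINT t|lborel. potential N t * deriv (deriv \<phi>) t)"
      unfolding q_def using pot_int[OF _ schwartz_deriv[OF schwartz_deriv[OF \<phi>]]] fin
      by (simp add: left_diff_distrib)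
    also have "\<dots> = D2 T \<phi>"
      using rep[OF \<phi>] integral_potential_deriv2[OF _ \<phi>] fin by simp
    finally show ?thesis using D2_apply[OF \<phi>] by simp
  qed
  obtain a b where ab: "\<And>\<psi>. \<psi> \<in> schwartz \<Longrightarrow> ?S \<psi> = (LINT t|lborel. (a + b * t) * \<psi> t)"
    using schwartz_linear_vanishing_on_deriv2[OF lin van] by blast
  have "continuous_representative T (\<lambda>t. a + b * t + q t)"
  proof (rule continuous_representativeI[OF T])
    show "continuous_on UNIV (\<lambda>t. a + b * t + q t)" by (intro continuous_intros q_cont)
    show "\<bar>a + b * t + q t\<bar> \<le> \<bar>a\<bar> + (\<bar>b\<bar> + C) * \<bar>t\<bar>" for t
      using q_bound[of t] abs_triangle_ineq[of "a + b * t" "q t"] abs_triangle_ineq[of a "b * t"]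
      by (simp add: algebra_simps abs_mult)
    fix \<phi> :: "real \<Rightarrow> real" assume \<phi>: "\<phi> \<in> schwartz"
    have "integrable lborel (\<lambda>t. (a + b * t) * \<phi> t)"
      by (rule integrable_linear_growth_schwartz[of _ "\<bar>a\<bar>" "\<bar>b\<bar>", OF _ _ \<phi>])
        (auto intro!: continuous_intros simp: abs_mult[symmetric])
    then show "T \<phi> = (LINT t|lborel. (a + b * t + q t) * \<phi> t)"
      using ab[OF \<phi>] q_int[OF \<phi>] by (simp add: distrib_right[of "a + b * _"])
  qed
  then show ?thesis using that dec unfolding q_def by blast
qed

lemma schwartz_le_seminorm:
  assumes "\<phi> \<in> schwartz" shows "\<bar>t ^ k * \<phi> t\<bar> \<le> schwartz_seminorm k 0 \<phi>"
proof -
  obtain C where "\<And>t. \<bar>t ^ k * \<phi> t\<bar> \<le> C" using schwartz_bound[OF assms] by blast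
  then have "bdd_above (range (\<lambda>t. \<bar>t ^ k * \<phi> t\<bar>))" by (rule bdd_aboveI2)
  then show ?thesis
    unfolding schwartz_seminorm_def funpow_0 by (rule cSUP_upper[OF UNIV_I])
qed

lemma affine_functional_bound:
  assumes "\<phi> \<in> schwartz" and small: "\<And>k. k \<le> 3 \<Longrightarrow> schwartz_seminorm k 0 \<phi> \<le> \<delta>"
  shows "integrable lborel (\<lambda>t. (a + b * t) * \<phi> t)"
    and "\<bar>LINT t|lborel. (a + b * t) * \<phi> t\<bar>
      \<le> 2 * (\<bar>a\<bar> + \<bar>b\<bar>) * \<delta> * (LINT t|lborel. 1 / (1 + t\<^sup>2))"
proof -
  have k: "\<bar>t ^ k * ((a + b * t) * \<phi> t)\<bar> \<le> (\<bar>a\<bar> + \<bar>b\<bar>) * \<delta>" if "k \<le> 2" for k t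
  proof -
    have "\<bar>t ^ k * ((a + b * t) * \<phi> t)\<bar> = \<bar>a * (t ^ k * \<phi> t) + b * (t ^ Suc k * \<phi> t)\<bar>"
      by (simp add: algebra_simps)
    also have "\<dots> \<le> \<bar>a\<bar> * \<bar>t ^ k * \<phi> t\<bar> + \<bar>b\<bar> * \<bar>t ^ Suc k * \<phi> t\<bar>"
      by (metis abs_mult abs_triangle_ineq)
    also have "\<dots> \<le> \<bar>a\<bar> * \<delta> + \<bar>b\<bar> * \<delta>"
      using that by (intro add_mono mult_left_mono order_trans[OF schwartz_le_seminorm[OF assms(1)] small]) auto
    finally show ?thesis by (simp add: distrib_right)
  qed
  have meas: "(\<lambda>t. (a + b * t) * \<phi> t) \<in> borel_measurable borel"
    using schwartz_measurable[OF assms(1)] by measurable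
  \<comment> \<open>Orders 0 and 2 are what integrability by decay asks for; with the factor t this involves seminorms up to order 3.\<close>
  have 0: "\<bar>(a + b * t) * \<phi> t\<bar> \<le> (\<bar>a\<bar> + \<bar>b\<bar>) * \<delta>" for t using k[of 0 t] by simp
  have 2: "\<bar>t\<^sup>2 * ((a + b * t) * \<phi> t)\<bar> \<le> (\<bar>a\<bar> + \<bar>b\<bar>) * \<delta>" for t using k[of 2 t] by simp
  show "integrable lborel (\<lambda>t. (a + b * t) * \<phi> t)"
    by (rule integrable_of_decay(1)[OF meas 0 2])
  show "\<bar>LINT t|lborel. (a + b * t) * \<phi> t\<bar>
      \<le> 2 * (\<bar>a\<bar> + \<bar>b\<bar>) * \<delta> * (LINT t|lborel. 1 / (1 + t\<^sup>2))"
    using integrable_of_decay(2)[OF meas 0 2] by (simp add: algebra_simps)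
qed

lemma integrable_affine_schwartz:
  "\<phi> \<in> schwartz \<Longrightarrow> integrable lborel (\<lambda>t. (a + b * t) * \<phi> t)"
  by (rule affine_functional_bound(1)[of _ "Max ((\<lambda>k. schwartz_seminorm k 0 \<phi>) ` {..3})"])
    (auto intro!: Max_ge)

lemma openin_schwartz_ball:
  "\<phi> \<in> schwartz \<Longrightarrow> \<epsilon> > 0 \<Longrightarrow>
    openin schwartz_topology {\<psi> \<in> schwartz. schwartz_seminorm k n (\<lambda>t. \<psi> t - \<phi> t) < \<epsilon>}"
  unfolding schwartz_topology_def by (rule topology_generated_by_Basis) blast

lemma schwartz_seminorm_0: "schwartz_seminorm k n (\<lambda>t. 0) = 0"
proof -
  have "(deriv ^^ n) (\<lambda>t. 0) = (\<lambda>t. 0 :: real)" by (induction n) auto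
  then show ?thesis by (simp add: schwartz_seminorm_def)
qed

lemma topspace_schwartz: "topspace schwartz_topology = schwartz"
proof
  show "topspace schwartz_topology \<subseteq> schwartz"
    unfolding schwartz_topology_def by auto
  show "schwartz \<subseteq> topspace schwartz_topology"
  proof
    fix \<phi> :: "real \<Rightarrow> real" assume "\<phi> \<in> schwartz"
    then have "openin schwartz_topology {\<psi> \<in> schwartz. schwartz_seminorm 0 0 (\<lambda>t. \<psi> t - \<phi> t) < 1}"
      by (rule openin_schwartz_ball) simp
    moreover have "\<phi> \<in> {\<psi> \<in> schwartz. schwartz_seminorm 0 0 (\<lambda>t. \<psi> t - \<phi> t) < 1}"
      using \<open>\<phi> \<in> schwartz\<close> by (simp add: schwartz_seminorm_0)
    ultimately show "\<phi> \<in> topspace schwartz_topology" using openin_subset by blast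
  qed
qed

text \<open>Only continuity takes work: four seminorms control the integral against an affine function, so the
intersection of four balls is mapped into any given neighbourhood.\<close>

lemma affine_distribution_tempered: "distribution_of (\<lambda>t. a + b * t) \<in> tempered_distributions"
proof -
  let ?T = "distribution_of (\<lambda>t. a + b * t)"
  have T: "?T \<phi> = (LINT t|lborel. (a + b * t) * \<phi> t)" if "\<phi> \<in> schwartz" for \<phi>
    using that by (simp add: distribution_of_def)
  note int = integrable_affine_schwartz[of _ a b]
  have add: "?T (\<lambda>t. \<phi> t + \<psi> t) = ?T \<phi> + ?T \<psi>" if "\<phi> \<in> schwartz" "\<psi> \<in> schwartz" for \<phi> \<psi>
    using int[OF that(1)] int[OF that(2)] that
    by (simp add: T schwartz_add distrib_left[of "a + b * _"])
  have scale: "?T (\<lambda>t. c * \<phi> t) = c * ?T \<phi>" if "\<phi> \<in> schwartz" for c \<phi>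
    using that by (simp add: T schwartz_scale mult.left_commute[of _ c])
  have "openin schwartz_topology {\<phi> \<in> schwartz. ?T \<phi> \<in> U}" if U: "open U" for U
  proof (subst openin_subopen, intro ballI)
    fix \<phi> assume "\<phi> \<in> {\<phi> \<in> schwartz. ?T \<phi> \<in> U}"
    then have \<phi>: "\<phi> \<in> schwartz" "?T \<phi> \<in> U" by auto
    obtain e where e: "e > 0" "ball (?T \<phi>) e \<subseteq> U" using U \<phi>(2) open_contains_ball by blast
    define I :: real where "I = (LINT t|lborel. 1 / (1 + t\<^sup>2))"
    have "I \<ge> 0" unfolding I_def by (intro integral_nonneg_AE AE_I2) simp
    define K where "K = 2 * (\<bar>a\<bar> + \<bar>b\<bar>) * I"
    have K: "K \<ge> 0" using \<open>I \<ge> 0\<close> by (simp add: K_def)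
    \<comment> \<open>The summand 1 keeps the radius meaningful when a and b are both 0.\<close>
    define \<delta> where "\<delta> = e / (K + 1)"
    have \<delta>: "\<delta> > 0" "K * \<delta> < e" using K e(1) by (auto simp: \<delta>_def field_simps)
    let ?V = "\<Inter>k\<in>{..3::nat}. {\<psi> \<in> schwartz. schwartz_seminorm k 0 (\<lambda>t. \<psi> t - \<phi> t) < \<delta>}"
    have "openin schwartz_topology ?V"
      by (intro openin_INT2 openin_schwartz_ball \<phi> \<delta>) auto
    moreover have "\<phi> \<in> ?V" using \<phi> \<delta> by (simp add: schwartz_seminorm_0)
    moreover have "?V \<subseteq> {\<phi> \<in> schwartz. ?T \<phi> \<in> U}"
    proof
      fix \<psi> assume \<psi>: "\<psi> \<in> ?V"
      then have \<psi>s: "\<psi> \<in> schwartz" by auto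
      have "\<bar>?T \<psi> - ?T \<phi>\<bar> = \<bar>LINT t|lborel. (a + b * t) * (\<psi> t - \<phi> t)\<bar>"
        using int[OF \<psi>s] int[OF \<phi>(1)] \<psi>s \<phi>(1) by (simp add: T right_diff_distrib[of "a + b * _"])
      also have "\<dots> \<le> 2 * (\<bar>a\<bar> + \<bar>b\<bar>) * \<delta> * I"
        unfolding I_def
        by (rule affine_functional_bound(2)) (use \<psi> \<psi>s \<phi>(1) in \<open>auto intro: schwartz_diff less_imp_le\<close>)
      also have "\<dots> < e" using \<delta>(2) by (simp add: K_def mult_ac)
      finally have "?T \<psi> \<in> ball (?T \<phi>) e" by (simp add: dist_real_def abs_minus_commute)
      then show "\<psi> \<in> {\<phi> \<in> schwartz. ?T \<phi> \<in> U}" using e(2) \<psi>s by blast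
    qed
    ultimately show "\<exists>V. openin schwartz_topology V \<and> \<phi> \<in> V \<and> V \<subseteq> {\<phi> \<in> schwartz. ?T \<phi> \<in> U}"
      by blast
  qed
  then have "continuous_map schwartz_topology euclideanreal ?T"
    by (simp add: continuous_map topspace_schwartz)
  moreover have "?T \<in> extensional schwartz" by (simp add: distribution_of_def)
  ultimately show ?thesis using add scale by (simp add: tempered_distributions_def)
qed

lemma affine_continuous_representative:
  "continuous_representative (distribution_of (\<lambda>t. a + b * t)) (\<lambda>t. a + b * t)"
  unfolding continuous_representative_def
  by (auto intro!: continuous_intros integrable_affine_schwartz)

text \<open>Set functions representing measures carry the default value outside the Borel sets, so the zero
measure is the restriction of 0 and not the constant function.\<close>

definition zero_measure :: "real set \<Rightarrow> real" where
  "zero_measure = (\<lambda>A\<in>sets borel. 0)"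

lemma zero_measure_decomposition: "signed_decomposition zero_measure (null_measure borel) (null_measure borel)"
  by (auto simp: signed_decomposition_def zero_measure_def finite_borel_measure_def measure_def
      intro!: finite_measureI)

lemma affine_D2: "represented_by_measure (D2 (distribution_of (\<lambda>t. a + b * t))) zero_measure"
  unfolding represented_by_measure_def
proof (intro exI conjI ballI)
  show "signed_decomposition zero_measure (null_measure borel) (null_measure borel)"
    by (rule zero_measure_decomposition)
  fix \<phi> :: "real \<Rightarrow> real" assume \<phi>: "\<phi> \<in> schwartz"
  note d = schwartz_deriv[OF \<phi>] and dd = schwartz_deriv[OF schwartz_deriv[OF \<phi>]]
  have "(LINT t|lborel. (a + b * t) * deriv (deriv \<phi>) t)
      = (LINT t|lborel. a * deriv (deriv \<phi>) t + b * (t * deriv (deriv \<phi>) t))"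
    by (simp add: algebra_simps)
  also have "\<dots> = a * (LINT t|lborel. deriv (deriv \<phi>) t) + b * (LINT t|lborel. t * deriv (deriv \<phi>) t)"
    using integrable_schwartz[OF dd] integrable_id_schwartz[OF dd] by simp
  also have "\<dots> = 0"
    using integral_deriv_schwartz[OF d] integral_id_deriv_schwartz[OF d] integral_deriv_schwartz[OF \<phi>]
    by simp
  finally show "D2 (distribution_of (\<lambda>t. a + b * t)) \<phi>
      = (LINT t|null_measure borel. \<phi> t) - (LINT t|null_measure borel. \<phi> t)"
    using dd by (simp add: D2_apply[OF \<phi>] distribution_of_def)
qed

lemma affine_BV2: "distribution_of (\<lambda>t. a + b * t) \<in> BV2"
proof -
  have "zero_measure \<in> radon_measures"
    using zero_measure_decomposition unfolding radon_measures_def by blast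
  then show ?thesis
    using affine_distribution_tempered affine_D2 unfolding BV2_def by blast
qed

section \<open>Total variation\<close>

lemma total_variation_bdd:
  assumes "signed_decomposition \<nu> P N"
  shows "bdd_above ((\<lambda>\<P>. \<Sum>A\<in>\<P>. \<bar>\<nu> A\<bar>) `
    {\<P>. finite \<P> \<and> \<P> \<subseteq> sets borel \<and> disjoint \<P> \<and> \<Union>\<P> = (UNIV :: real set)})"
proof (rule bdd_aboveI2)
  have fin: "finite_borel_measure P" "finite_borel_measure N"
    using assms by (auto simp: signed_decomposition_def)
  fix \<P> :: "real set set"
  assume \<P>: "\<P> \<in> {\<P>. finite \<P> \<and> \<P> \<subseteq> sets borel \<and> disjoint \<P> \<and> \<Union>\<P> = UNIV}"
  have sum: "(\<Sum>A\<in>\<P>. measure \<mu> A) = measure \<mu> UNIV" if \<mu>: "finite_borel_measure \<mu>" for \<mu>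
  proof -
    interpret finite_measure \<mu> by (rule finite_borel_measure_facts) fact
    have "measure \<mu> (\<Union>A\<in>\<P>. A) = (\<Sum>A\<in>\<P>. measure \<mu> A)"
      using \<P> finite_borel_measure_facts(1)[OF \<mu>]
      by (intro finite_measure_finite_Union) (auto simp: disjoint_family_on_def disjoint_def)
    then show ?thesis using \<P> by simp
  qed
  have "(\<Sum>A\<in>\<P>. \<bar>\<nu> A\<bar>) \<le> (\<Sum>A\<in>\<P>. measure P A + measure N A)"
  proof (rule sum_mono)
    fix A assume "A \<in> \<P>"
    then have "A \<in> sets borel" using \<P> by blast
    then have "\<nu> A = measure P A - measure N A" using assms by (simp add: signed_decomposition_def)
    then show "\<bar>\<nu> A\<bar> \<le> measure P A + measure N A"
      using measure_nonneg[of P A] measure_nonneg[of N A] by linarith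
  qed
  then show "(\<Sum>A\<in>\<P>. \<bar>\<nu> A\<bar>) \<le> measure P UNIV + measure N UNIV"
    using sum fin by (simp add: sum.distrib)
qed

text \<open>Partitions into a set and its complement suffice below: they detect nonzero measures, and the Hahn
decomposition is one of them.\<close>

lemma two_set_le_total_variation:
  assumes "signed_decomposition \<nu> P N" "Y \<in> sets borel"
  shows "\<bar>\<nu> Y\<bar> + \<bar>\<nu> (- Y)\<bar> \<le> total_variation \<nu>"
proof -
  have "Y \<noteq> - Y" by blast
  then have "\<bar>\<nu> Y\<bar> + \<bar>\<nu> (- Y)\<bar> = (\<Sum>A\<in>{Y, - Y}. \<bar>\<nu> A\<bar>)" by simp
  also have "\<dots> \<le> total_variation \<nu>"
    unfolding total_variation_def
    by (rule cSUP_upper[OF _ total_variation_bdd[OF assms(1)]])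
      (use assms(2) in \<open>auto simp: disjoint_def\<close>)
  finally show ?thesis .
qed

lemma total_variation_nonneg: "signed_decomposition \<nu> P N \<Longrightarrow> 0 \<le> total_variation \<nu>"
  using two_set_le_total_variation[of \<nu> P N UNIV] by simp

lemma total_variation_zero_measure: "total_variation zero_measure = 0"
proof -
  let ?\<P> = "{\<P>. finite \<P> \<and> \<P> \<subseteq> sets borel \<and> disjoint \<P> \<and> \<Union>\<P> = (UNIV :: real set)}"
  have "(\<Sum>A\<in>\<P>. \<bar>zero_measure A\<bar>) = 0" if "\<P> \<in> ?\<P>" for \<P>
    using that by (intro sum.neutral) (auto simp: zero_measure_def subset_eq)
  then have "total_variation zero_measure = (SUP \<P>\<in>?\<P>. 0)"
    unfolding total_variation_def by (intro SUP_cong refl) auto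
  also have "{UNIV} \<in> ?\<P>" by (simp add: disjoint_def)
  then have "(SUP \<P>\<in>?\<P>. 0 :: real) = 0" by (intro cSUP_const) blast
  finally show ?thesis .
qed

lemma total_variation_eq_0D:
  assumes "signed_decomposition \<nu> P N" "total_variation \<nu> = 0"
  shows "\<nu> = zero_measure"
proof
  fix A
  show "\<nu> A = zero_measure A"
  proof (cases "A \<in> sets borel")
    case True
    then show ?thesis
      using two_set_le_total_variation[OF assms(1) True] assms(2) by (simp add: zero_measure_def)
  next
    case False
    then show ?thesis using assms(1) by (simp add: signed_decomposition_def zero_measure_def)
  qed
qed

text \<open>Domination of the measures of all subsets of Y transfers to integrals over Y by comparing the two
measures with density the indicator of Y.\<close>

lemma integral_mono_measure_on:
  fixes f :: "real \<Rightarrow> real"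
  assumes fin: "finite_borel_measure N" "finite_borel_measure M" and Y: "Y \<in> sets borel"
    and le: "\<And>X. X \<in> sets borel \<Longrightarrow> X \<subseteq> Y \<Longrightarrow> emeasure N X \<le> emeasure M X"
    and f: "f \<in> borel_measurable borel" "\<And>t. 0 \<le> f t" "\<And>t. f t \<le> B"
  shows "(LINT t|N. indicator Y t * f t) \<le> (LINT t|M. indicator Y t * f t)"
proof -
  note s[measurable_cong] = fin[THEN finite_borel_measure_facts(1)]
  note [measurable] = f(1) Y
  have int: "integrable \<mu> (\<lambda>t. indicator Y t * f t)" if "finite_borel_measure \<mu>" for \<mu>
    by (rule integrable_finite_borel[OF that, of _ "max B 0"])
      (use f in \<open>auto simp: indicator_def le_max_iff_disj\<close>)
  have nn: "(\<integral>\<^sup>+t. f t \<partial>density \<mu> (indicator Y)) = ennreal (LINT t|\<mu>. indicator Y t * f t)"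
    if \<mu>: "finite_borel_measure \<mu>" for \<mu>
  proof -
    note [measurable_cong] = finite_borel_measure_facts(1)[OF \<mu>]
    have "(\<integral>\<^sup>+t. f t \<partial>density \<mu> (indicator Y)) = (\<integral>\<^sup>+t. ennreal (indicator Y t * f t) \<partial>\<mu>)"
      by (subst nn_integral_density) (auto intro!: nn_integral_cong simp: indicator_def)
    also have "\<dots> = ennreal (LINT t|\<mu>. indicator Y t * f t)"
      by (rule nn_integral_eq_integral[OF int[OF \<mu>]]) (use f(2) in auto)
    finally show ?thesis .
  qed
  have "density N (indicator Y) \<le> density M (indicator Y)"
  proof (rule le_measure[THEN iffD2])
    show "sets (density N (indicator Y)) = sets (density M (indicator Y))" using s by simp
    show "\<forall>X\<in>sets (density N (indicator Y)).
        emeasure (density N (indicator Y)) X \<le> emeasure (density M (indicator Y)) X"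
    proof
      fix X assume "X \<in> sets (density N (indicator Y))"
      then have "X \<in> sets borel" using s by simp
      then show "emeasure (density N (indicator Y)) X \<le> emeasure (density M (indicator Y)) X"
        using le[of "Y \<inter> X"] Y s by (simp add: emeasure_density indicator_inter_arith[symmetric])
    qed
  qed
  then have "(\<integral>\<^sup>+t. f t \<partial>density N (indicator Y)) \<le> (\<integral>\<^sup>+t. f t \<partial>density M (indicator Y))"
    using s by (intro nn_integral_mono_measure) auto
  moreover have "0 \<le> (LINT t|M. indicator Y t * f t)"
    using f(2) by (intro integral_nonneg_AE AE_I2) simp
  ultimately show ?thesis by (simp add: nn fin ennreal_le_iff)
qed

text \<open>On a Hahn set Y the measure P dominates N, and integrating C - \<eta> \<ge> 0 over Y gives
\<integral>_Y \<eta> d(P-N) \<le> C (P-N)(Y). On the complement the roles are exchanged and C +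
\<eta> \<ge> 0 is used.\<close>

lemma integral_le_total_variation:
  fixes \<eta> :: "real \<Rightarrow> real"
  assumes dec: "signed_decomposition \<nu> P N"
    and \<eta>: "\<eta> \<in> borel_measurable borel" "\<And>t. \<bar>\<eta> t\<bar> \<le> C"
  shows "(LINT t|P. \<eta> t) - (LINT t|N. \<eta> t) \<le> C * total_variation \<nu>"
proof -
  have fin: "finite_borel_measure P" "finite_borel_measure N"
    using dec by (auto simp: signed_decomposition_def)
  note s = fin[THEN finite_borel_measure_facts(1)]
  have "\<exists>Y\<in>sets P. (\<forall>X\<in>sets P. X \<subseteq> Y \<longrightarrow> emeasure N X \<le> emeasure P X)
      \<and> (\<forall>X\<in>sets P. X \<inter> Y = {} \<longrightarrow> emeasure P X \<le> emeasure N X)"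
    by (intro finite_unsigned_Hahn_decomposition finite_borel_measure_facts(3) fin) (simp add: s)
  then obtain Y where Y: "Y \<in> sets borel"
    and "\<forall>X\<in>sets borel. X \<subseteq> Y \<longrightarrow> emeasure N X \<le> emeasure P X"
    and "\<forall>X\<in>sets borel. X \<inter> Y = {} \<longrightarrow> emeasure P X \<le> emeasure N X"
    unfolding s by (elim bexE conjE)
  then have le: "X \<in> sets borel \<Longrightarrow> X \<subseteq> Y \<Longrightarrow> emeasure N X \<le> emeasure P X"
    and ge: "X \<in> sets borel \<Longrightarrow> X \<inter> Y = {} \<Longrightarrow> emeasure P X \<le> emeasure N X" for X
    by simp_all
  have C: "0 \<le> C" using \<eta>(2)[of 0] by linarith
  have int: "integrable \<mu> (\<lambda>t. indicator A t * \<eta> t)" "integrable \<mu> (\<lambda>t. indicator A t * C)"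
    if "finite_borel_measure \<mu>" "A \<in> sets borel" for \<mu> A
  proof -
    have [measurable]: "A \<in> sets borel" "\<eta> \<in> borel_measurable borel" by (fact that(2)) (fact \<eta>(1))
    show "integrable \<mu> (\<lambda>t. indicator A t * \<eta> t)" "integrable \<mu> (\<lambda>t. indicator A t * C)"
      by (rule integrable_finite_borel[OF that(1), of _ C]; use \<eta>(2) C in \<open>auto simp: indicator_def\<close>)+
  qed
  have const: "(LINT t|\<mu>. indicator A t * C) = C * measure \<mu> A"
    if "finite_borel_measure \<mu>" "A \<in> sets borel" for \<mu> A
    using finite_borel_measure_facts(2)[OF that(1)] by simp
  have split: "(LINT t|\<mu>. \<eta> t) = (LINT t|\<mu>. indicator Y t * \<eta> t) + (LINT t|\<mu>. indicator (- Y) t * \<eta> t)"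
    if "finite_borel_measure \<mu>" for \<mu>
  proof -
    have "(LINT t|\<mu>. \<eta> t) = (LINT t|\<mu>. indicator Y t * \<eta> t + indicator (- Y) t * \<eta> t)"
      by (intro Bochner_Integration.integral_cong) (auto simp: indicator_def)
    also have "\<dots> = (LINT t|\<mu>. indicator Y t * \<eta> t) + (LINT t|\<mu>. indicator (- Y) t * \<eta> t)"
      by (intro Bochner_Integration.integral_add int that) (use Y in auto)
    finally show ?thesis .
  qed
  have lin: "(LINT t|\<mu>. indicator A t * (C + r * \<eta> t)) = C * measure \<mu> A + r * (LINT t|\<mu>. indicator A t * \<eta> t)"
    if "finite_borel_measure \<mu>" "A \<in> sets borel" for \<mu> A r
  proof -
    have "(LINT t|\<mu>. indicator A t * (C + r * \<eta> t)) = (LINT t|\<mu>. indicator A t * C + r * (indicator A t * \<eta> t))"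
      by (simp add: algebra_simps)
    also have "\<dots> = (LINT t|\<mu>. indicator A t * C) + r * (LINT t|\<mu>. indicator A t * \<eta> t)"
      using int[OF that] by simp
    finally show ?thesis using const[OF that] by simp
  qed
  have b: "0 \<le> C + r * \<eta> t \<and> C + r * \<eta> t \<le> 2 * C" if "r = 1 \<or> r = -1" for r t
    using \<eta>(2)[of t] that by (auto simp: abs_le_iff)
  have on: "(LINT t|N. indicator Y t * (C + (-1) * \<eta> t)) \<le> (LINT t|P. indicator Y t * (C + (-1) * \<eta> t))"
    using b[of "-1"] \<eta>(1) by (intro integral_mono_measure_on[of _ _ _ _ "2 * C"] fin Y le) auto
  have Y': "- Y \<in> sets borel" using Y by simp
  have off: "(LINT t|P. indicator (- Y) t * (C + 1 * \<eta> t)) \<le> (LINT t|N. indicator (- Y) t * (C + 1 * \<eta> t))"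
    using b[of 1] \<eta>(1) Y by (intro integral_mono_measure_on[of _ _ _ _ "2 * C"] fin ge) auto
  have
    "(LINT t|P. \<eta> t) - (LINT t|N. \<eta> t) \<le> C * (measure P Y - measure N Y) + C * (measure N (- Y) - measure P (- Y))"
    using on off unfolding lin[OF fin(1) Y] lin[OF fin(2) Y] lin[OF fin(1) Y'] lin[OF fin(2) Y']
      split[OF fin(1)] split[OF fin(2)] by (simp add: right_diff_distrib)
  also have "\<dots> \<le> C * \<bar>\<nu> Y\<bar> + C * \<bar>\<nu> (- Y)\<bar>"
    using dec Y C by (intro add_mono mult_left_mono) (auto simp: signed_decomposition_def)
  also have "\<dots> \<le> C * total_variation \<nu>"
    using mult_left_mono[OF two_set_le_total_variation[OF dec Y] C] by (simp add: distrib_left)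
  finally show ?thesis .
qed

section \<open>The pseudoinverse of an injective matrix\<close>

text \<open>If X and Y both satisfy the Penrose equations, AX and AY are symmetric with AX = AYAX, so
transposing gives AX = AXAY = AY; likewise XA = YA. Then X = XAX = XAY = YAY = Y.\<close>

lemma penrose_unique:
  fixes A :: "real mat"
  assumes A: "A \<in> carrier_mat m n"
    and X: "X \<in> carrier_mat n m" "A * X * A = A" "X * A * X = X"
      "transpose_mat (A * X) = A * X" "transpose_mat (X * A) = X * A"
    and Y: "Y \<in> carrier_mat n m" "A * Y * A = A" "Y * A * Y = Y"
      "transpose_mat (A * Y) = A * Y" "transpose_mat (Y * A) = Y * A"
  shows "X = Y"
proof -
  have AX: "A * X \<in> carrier_mat m m" and AY: "A * Y \<in> carrier_mat m m"
    and XA: "X * A \<in> carrier_mat n n" and YA: "Y * A \<in> carrier_mat n n"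
    using A X(1) Y(1) by auto
  have "A * X = (A * Y) * (A * X)"
    using assoc_mult_mat[OF AY A X(1)] Y(2) by simp
  then have "A * X = transpose_mat ((A * Y) * (A * X))" using X(4) by simp
  also have "\<dots> = (A * X) * (A * Y)"
    using transpose_mult[OF AY AX] X(4) Y(4) by simp
  also have "\<dots> = (A * X * A) * Y" using assoc_mult_mat[OF AX A Y(1)] by simp
  finally have l: "A * X = A * Y" using X(2) by simp
  have "X * A = (X * A) * (Y * A)"
    using assoc_mult_mat[OF X(1) A YA] assoc_mult_mat[OF A Y(1) A] Y(2) by simp
  then have "X * A = transpose_mat ((X * A) * (Y * A))" using X(5) by simp
  also have "\<dots> = (Y * A) * (X * A)"
    using transpose_mult[OF XA YA] X(5) Y(5) by simp
  also have "\<dots> = Y * (A * X * A)" 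
    using assoc_mult_mat[OF Y(1) A XA] assoc_mult_mat[OF A X(1) A] by simp
  finally have r: "X * A = Y * A" using X(2) by simp
  have "X = X * (A * X)" using assoc_mult_mat[OF X(1) A X(1)] X(3) by simp
  also have "\<dots> = (X * A) * Y" using assoc_mult_mat[OF X(1) A Y(1)] l by simp
  also have "\<dots> = Y" using r Y(3) by simp
  finally show ?thesis .
qed

text \<open>For injective A the Gram matrix A^TA is invertible and (A^TA)^(-1)A^T is a left inverse satisfying
the Penrose equations; it is the pseudoinverse.\<close>

lemma pseudoinverse_injective:
  fixes A :: "real mat"
  assumes A: "A \<in> carrier_mat m n"
    and inj: "\<And>u. u \<in> carrier_vec n \<Longrightarrow> A *\<^sub>v u = 0\<^sub>v m \<Longrightarrow> u = 0\<^sub>v n"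
    and u: "u \<in> carrier_vec n"
  shows "pseudoinverse A *\<^sub>v (A *\<^sub>v u) = u"
proof -
  let ?T = "transpose_mat A"
  have T: "?T \<in> carrier_mat n m" using A by simp
  let ?G = "?T * A"
  have G: "?G \<in> carrier_mat n n" using A by simp
  have "det ?G \<noteq> 0"
  proof
    assume "det ?G = 0"
    then obtain v where v: "v \<in> carrier_vec n" "v \<noteq> 0\<^sub>v n" "?G *\<^sub>v v = 0\<^sub>v n"
      using det_0_iff_vec_prod_zero_field[OF G] by blast
    let ?w = "A *\<^sub>v v"
    have w: "?w \<in> carrier_vec m" using A v(1) by simp
    have "?T *\<^sub>v ?w = 0\<^sub>v n" using v assoc_mult_mat_vec[OF T A v(1)] by simp
    then have "?w \<bullet> ?w = 0"
      using transpose_vec_mult_scalar[OF A v(1) w] v(1) by simp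
    then have "(\<Sum>i\<in>{0..<m}. ?w $ i * ?w $ i) = 0"
      using carrier_vecD[OF w] by (simp only: scalar_prod_def)
    then have "?w $ i = 0" if "i < m" for i
      using that by (subst (asm) sum_nonneg_eq_0_iff) auto
    then have "?w = 0\<^sub>v m" using carrier_vecD[OF w] A by (intro eq_vecI) auto
    then show False using inj v by blast
  qed
  then have "?G \<in> Units (ring_mat TYPE(real) n ())" by (rule det_non_zero_imp_unit[OF G])
  then obtain B where B: "B \<in> carrier_mat n n" "B * ?G = 1\<^sub>m n" "?G * B = 1\<^sub>m n"
    unfolding Units_def ring_mat_def by auto
  have Gs: "transpose_mat ?G = ?G" using transpose_mult[OF T A] by simp
  have Bs: "transpose_mat B = B"
  proof -
    have BT: "transpose_mat B \<in> carrier_mat n n" using B(1) by simp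
    have "transpose_mat B = transpose_mat B * (?G * B)" using B BT by simp
    also have "\<dots> = (transpose_mat B * ?G) * B" using assoc_mult_mat[OF BT G B(1)] by simp
    also have "transpose_mat B * ?G = transpose_mat (?G * B)"
      using transpose_mult[OF G B(1)] Gs by simp
    also have "\<dots> = 1\<^sub>m n" using B(3) by simp
    finally show ?thesis using B(1) by simp
  qed
  let ?X = "B * ?T"
  have X: "?X \<in> carrier_mat n m" using B(1) T by simp
  have XA: "?X * A = 1\<^sub>m n" using assoc_mult_mat[OF B(1) T A] B(2) by simp
  have AX: "A * ?X \<in> carrier_mat m m" using A X by simp
  have p2: "A * ?X * A = A" using assoc_mult_mat[OF A X A] XA A by simp
  have p3: "?X * A * ?X = ?X" unfolding XA by (rule left_mult_one_mat[OF X])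
  have p4: "transpose_mat (A * ?X) = A * ?X"
  proof -
    have "transpose_mat (A * ?X) = transpose_mat ?X * ?T" by (rule transpose_mult[OF A X])
    also have "transpose_mat ?X = A * B" using transpose_mult[OF B(1) T] Bs by simp
    also have "A * B * ?T = A * ?X" by (rule assoc_mult_mat[OF A B(1) T])
    finally show ?thesis .
  qed
  have p5: "transpose_mat (?X * A) = ?X * A" using XA by simp
  have "pseudoinverse A = ?X"
    unfolding pseudoinverse_def
  proof (rule the_equality)
    show "?X \<in> carrier_mat (dim_col A) (dim_row A) \<and> A * ?X * A = A \<and> ?X * A * ?X = ?X \<and>
        transpose_mat (A * ?X) = A * ?X \<and> transpose_mat (?X * A) = ?X * A"
      using X A p2 p3 p4 p5 by auto
    fix Y
    assume "Y \<in> carrier_mat (dim_col A) (dim_row A) \<and> A * Y * A = A \<and> Y * A * Y = Y \<and>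
        transpose_mat (A * Y) = A * Y \<and> transpose_mat (Y * A) = Y * A"
    then show "Y = ?X"
      using penrose_unique[OF A _ _ _ _ _ X p2 p3 p4 p5] A by auto
  qed
  moreover have "?X *\<^sub>v (A *\<^sub>v u) = u"
    using assoc_mult_mat_vec[OF X A u] XA u by simp
  ultimately show ?thesis by simp
qed

section \<open>Summation by parts\<close>

lemma summation_by_parts_inner:
  fixes H d :: "nat \<Rightarrow> real"
  shows "(\<Sum>i<K. H (i + 1) * (d (i + 1) - d i))
    = H (K + 1) * d K - H 0 * d 0 - (\<Sum>i<K + 1. (H (i + 1) - H i) * d i)"
  by (induction K) (simp_all add: algebra_simps)

lemma summation_by_parts_outer:
  fixes e z :: "nat \<Rightarrow> real"
  shows "(\<Sum>i<n. (\<Sum>m\<le>i. e m) * (z (i + 1) - z i)) = (\<Sum>m\<le>n. e m) * z n - (\<Sum>m\<le>n. e m * z m)"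
  by (induction n) (simp_all add: algebra_simps)

section \<open>The dual spline and the matrix L\<close>

text \<open>For weights e whose moments of order 0 and 1 vanish, this is the function \<eta> that turns the
functional f \<mapsto> \<Sum>_m e_m f(x_m) into integration of \<eta> against f''. It is the dual
certificate of both optimization problems.\<close>

definition dual_spline :: "nat \<Rightarrow> (nat \<Rightarrow> real) \<Rightarrow> (nat \<Rightarrow> real) \<Rightarrow> real \<Rightarrow> real" where
  "dual_spline M e X \<tau> = (\<Sum>m<M. e m * max 0 (X m - \<tau>))"

lemma dual_spline_beyond:
  assumes "\<And>m. m < M \<Longrightarrow> X m \<le> \<tau>" shows "dual_spline M e X \<tau> = 0"
  using assms by (auto simp: dual_spline_def intro!: sum.neutral)

lemma dual_spline_before:
  assumes "\<And>m. m < M \<Longrightarrow> \<tau> \<le> X m" "(\<Sum>m<M. e m) = 0" "(\<Sum>m<M. e m * X m) = 0"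
  shows "dual_spline M e X \<tau> = 0"
proof -
  have "dual_spline M e X \<tau> = (\<Sum>m<M. e m * X m - \<tau> * e m)"
    unfolding dual_spline_def using assms(1) by (intro sum.cong) (auto simp: max_def algebra_simps)
  also have "\<dots> = 0" using assms(2,3) by (simp add: sum_subtractf flip: sum_distrib_left)
  finally show ?thesis .
qed

lemma dual_spline_continuous: "continuous_on A (dual_spline M e X)"
  unfolding dual_spline_def by (intro continuous_intros)

lemma dual_spline_interpolate:
  assumes s: "0 \<le> s" "s \<le> 1" and ab: "a \<le> b"
    and knots: "\<And>m. m < M \<Longrightarrow> X m \<le> a \<or> b \<le> X m"
  shows "dual_spline M e X ((1 - s) * a + s * b)
    = (1 - s) * dual_spline M e X a + s * dual_spline M e X b"
proof -
  let ?t = "(1 - s) * a + s * b"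
  have t: "?t = a + s * (b - a)" by (simp add: algebra_simps)
  have "0 \<le> s * (b - a)" "s * (b - a) \<le> b - a"
    using s ab mult_right_mono[of s 1 "b - a"] by auto
  then have "a \<le> ?t" "?t \<le> b" using t by linarith+
  have ramp: "max 0 (X m - ?t) = (1 - s) * max 0 (X m - a) + s * max 0 (X m - b)" if "m < M" for m
  proof (cases "X m \<le> a")
    case True
    then have "max 0 (X m - ?t) = 0" "max 0 (X m - a) = 0" "max 0 (X m - b) = 0"
      using \<open>a \<le> ?t\<close> ab by auto
    then show ?thesis by simp
  next
    case False
    then have "b \<le> X m" using knots[OF that] by blast
    then have "max 0 (X m - ?t) = X m - ?t" "max 0 (X m - a) = X m - a" "max 0 (X m - b) = X m - b"
      using \<open>?t \<le> b\<close> ab by auto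
    then show ?thesis by (simp add: algebra_simps)
  qed
  have "dual_spline M e X ?t
      = (\<Sum>m<M. e m * ((1 - s) * max 0 (X m - a) + s * max 0 (X m - b)))"
    unfolding dual_spline_def by (intro sum.cong) (simp_all only: ramp lessThan_iff)
  then show ?thesis
    by (simp only: dual_spline_def sum_distrib_left sum.distrib distrib_left mult.left_commute)
qed

text \<open>The vanishing moments are all that the duality uses about the residual slopes of the regression
line.\<close>

locale moment_free_weights =
  fixes M :: nat and x :: "real vec" and e :: "nat \<Rightarrow> real"
  assumes M2: "M \<ge> 2" and x_dim: "x \<in> carrier_vec M"
    and incr: "\<And>i j. i < j \<Longrightarrow> j < M \<Longrightarrow> x $ i < x $ j"
    and moment0: "(\<Sum>m<M. e m) = 0"
    and moment1: "(\<Sum>m<M. e m * x $ m) = 0"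
begin

abbreviation \<eta> :: "real \<Rightarrow> real" where "\<eta> \<equiv> dual_spline M e (\<lambda>m. x $ m)"

lemma incr_le: "i \<le> j \<Longrightarrow> j < M \<Longrightarrow> x $ i \<le> x $ j"
  using incr[of i j] by (cases "i = j") auto

lemma \<eta>_first: "\<eta> (x $ 0) = 0"
  by (rule dual_spline_before[OF _ moment0 moment1]) (simp add: incr_le)

lemma \<eta>_last: "\<eta> (x $ (M - 1)) = 0"
  by (rule dual_spline_beyond) (use M2 in \<open>simp add: incr_le\<close>)

text \<open>A continuous function that is affine between consecutive knots attains its extrema at knots, and
outside the data range and at both end knots \<eta> vanishes. So the interior knot values decide.\<close>

lemma \<eta>_bound:
  assumes C: "0 \<le> C" "\<And>i. i < M - 2 \<Longrightarrow> \<bar>\<eta> (x $ (i + 1))\<bar> \<le> C"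
  shows "\<bar>\<eta> \<tau>\<bar> \<le> C"
proof -
  have knot: "\<bar>\<eta> (x $ j)\<bar> \<le> C" if j: "j < M" for j
  proof -
    consider "j = 0" | "j = M - 1" | i where "j = i + 1" "i < M - 2"
      using j by (cases j; cases "j = M - 1") auto
    then show ?thesis using C \<eta>_first \<eta>_last by cases auto
  qed
  consider "\<And>m. m < M \<Longrightarrow> x $ m \<le> \<tau>" | "\<tau> \<le> x $ 0" | k where "k < M" "\<tau> < x $ k" "x $ 0 < \<tau>"
    by (meson linorder_not_less)
  then show ?thesis
  proof cases
    case 1
    then show ?thesis using C(1) dual_spline_beyond[of M "\<lambda>m. x $ m"] by simp
  next
    case 2
    then have "\<tau> \<le> x $ m" if "m < M" for m using incr_le[of 0 m] that by simp
    then show ?thesis using C(1) dual_spline_before[OF _ moment0 moment1] by simp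
  next
    case 3
    \<comment> \<open>The first knot beyond the point and its predecessor enclose it.\<close>
    define l where "l = (LEAST k. \<tau> < x $ k)"
    have l: "\<tau> < x $ l" and l_le: "l \<le> k" unfolding l_def using 3 by (auto intro: LeastI Least_le)
    have "l \<noteq> 0" using l 3 by (metis less_asym)
    then obtain j where j: "l = j + 1" by (metis Suc_eq_plus1 not0_implies_Suc)
    then have "\<not> \<tau> < x $ j" using not_less_Least[of j "\<lambda>k. \<tau> < x $ k"] l_def by simp
    then have xj: "x $ j \<le> \<tau>" by simp
    have jM: "j + 1 < M" using j l_le 3 by simp
    have gap: "x $ j < x $ (j + 1)" using incr[of j "j + 1"] jM by simp
    define s where "s = (\<tau> - x $ j) / (x $ (j + 1) - x $ j)"
    have s: "0 \<le> s" "s \<le> 1" using gap xj l j by (auto simp: s_def)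
    have "\<tau> = (1 - s) * x $ j + s * x $ (j + 1)"
    proof -
      have "s * (x $ (j + 1) - x $ j) = \<tau> - x $ j" using gap by (simp add: s_def)
      then show ?thesis by (simp add: algebra_simps)
    qed
    moreover have "x $ m \<le> x $ j \<or> x $ (j + 1) \<le> x $ m" if "m < M" for m
      using that jM incr_le[of m j] incr_le[of "j + 1" m] by (cases "m \<le> j") auto
    ultimately have "\<eta> \<tau> = (1 - s) * \<eta> (x $ j) + s * \<eta> (x $ (j + 1))"
      using dual_spline_interpolate[OF s less_imp_le[OF gap], of M "\<lambda>m. x $ m" e] by simp
    also have "\<bar>\<dots>\<bar> \<le> (1 - s) * \<bar>\<eta> (x $ j)\<bar> + s * \<bar>\<eta> (x $ (j + 1))\<bar>"
      using s by (intro order_trans[OF abs_triangle_ineq]) (simp add: abs_mult)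
    also have "\<dots> \<le> (1 - s) * C + s * C"
      using s knot jM by (intro add_mono mult_left_mono) auto
    finally show ?thesis by (simp add: algebra_simps)
  qed
qed

text \<open>The slope of \<eta> between two knots is minus the sum of the weights to the right, which equals
the sum of those to the left since the total is 0.\<close>

lemma \<eta>_slope:
  assumes "i + 1 < M"
  shows "\<eta> (x $ (i + 1)) - \<eta> (x $ i) = (x $ (i + 1) - x $ i) * (\<Sum>m\<le>i. e m)"
proof -
  let ?g = "x $ (i + 1) - x $ i"
  have "max 0 (x $ m - x $ (i + 1)) - max 0 (x $ m - x $ i) = (if m \<le> i then 0 else - ?g)"
    if "m < M" for m
    using that assms incr_le[of m i] incr_le[of i "i + 1"] incr_le[of "i + 1" m]
    by (cases "m \<le> i") (auto simp: max_def)
  then have "\<eta> (x $ (i + 1)) - \<eta> (x $ i) = (\<Sum>m<M. e m * (if m \<le> i then 0 else - ?g))"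
    unfolding dual_spline_def sum_subtractf[symmetric] right_diff_distrib[symmetric]
    by (intro sum.cong) auto
  also have "\<dots> = (\<Sum>m<M. ?g * (if m \<le> i then e m else 0) - ?g * e m)"
    by (intro sum.cong) (auto simp: algebra_simps)
  also have "\<dots> = ?g * (\<Sum>m<M. if m \<le> i then e m else 0)"
    using moment0 by (simp add: sum_subtractf flip: sum_distrib_left)
  also have "(\<Sum>m<M. if m \<le> i then e m else 0) = (\<Sum>m\<le>i. e m)"
    using assms by (intro sum.mono_neutral_cong_right) auto
  finally show ?thesis .
qed

lemma L_mat_carrier: "L_mat x \<in> carrier_mat (M - 2) M"
  using x_dim by (simp add: L_mat_def)

lemma L_mat_mult_vec:
  assumes z: "z \<in> carrier_vec M" and i: "i < M - 2"
  defines "d \<equiv> \<lambda>i. inv_gap x i * (z $ (i + 1) - z $ i)"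
  shows "(L_mat x *\<^sub>v z) $ i = d (i + 1) - d i"
proof -
  have "(L_mat x *\<^sub>v z) $ i = (\<Sum>j\<in>{0..<M}. L_mat x $$ (i, j) * z $ j)"
    using i z x_dim by (simp add: L_mat_def scalar_prod_def)
  also have "\<dots> = (\<Sum>j\<in>{i, i + 1, i + 2}. L_mat x $$ (i, j) * z $ j)"
    using i x_dim by (intro sum.mono_neutral_right) (auto simp: L_mat_def)
  also have "\<dots> = d (i + 1) - d i"
    using i x_dim by (simp add: L_mat_def d_def algebra_simps)
  finally show ?thesis .
qed

definition knot_values :: "real vec" where
  "knot_values = vec (M - 2) (\<lambda>i. \<eta> (x $ (i + 1)))"

lemma knot_values_carrier: "knot_values \<in> carrier_vec (M - 2)"
  by (simp add: knot_values_def)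

text \<open>Two summations by parts. The entries of L z are differences of the divided differences of z, so
the first one moves a difference onto \<eta>, whose divided differences are partial sums of e; the
second one moves the remaining difference from z onto these partial sums. The boundary terms
vanish because \<eta> is 0 at the end knots and e sums to 0.\<close>

lemma knot_values_pairing:
  assumes z: "z \<in> carrier_vec M"
  shows "knot_values \<bullet> (L_mat x *\<^sub>v z) = (\<Sum>m<M. e m * z $ m)"
proof -
  define d where "d i = inv_gap x i * (z $ (i + 1) - z $ i)" for i
  obtain K where K: "M = K + 2" using M2 by (metis add.commute le_Suc_ex)
  let ?H = "\<lambda>i. \<eta> (x $ i)"
  have "knot_values \<bullet> (L_mat x *\<^sub>v z) = (\<Sum>i<K. ?H (i + 1) * (d (i + 1) - d i))"
    unfolding scalar_prod_def
  proof (rule sum.cong)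
    show "{0..<dim_vec (L_mat x *\<^sub>v z)} = {..<K}" using L_mat_carrier K by auto
    fix i assume "i \<in> {..<K}"
    then have "i < M - 2" using K by simp
    then show "knot_values $ i * (L_mat x *\<^sub>v z) $ i = ?H (i + 1) * (d (i + 1) - d i)"
      unfolding L_mat_mult_vec[OF z \<open>i < M - 2\<close>] d_def by (simp add: knot_values_def)
  qed
  also have "\<dots> = - (\<Sum>i<K + 1. (?H (i + 1) - ?H i) * d i)"
    using summation_by_parts_inner[of ?H d K] \<eta>_first \<eta>_last K by simp
  also have "(\<Sum>i<K + 1. (?H (i + 1) - ?H i) * d i) = (\<Sum>i<K + 1. (\<Sum>m\<le>i. e m) * (z $ (i + 1) - z $ i))"
  proof (rule sum.cong)
    fix i assume "i \<in> {..<K + 1}"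
    then have i: "i + 1 < M" using K by simp
    then have "x $ (i + 1) - x $ i \<noteq> 0" using incr[of i "i + 1"] by simp
    then show "(?H (i + 1) - ?H i) * d i = (\<Sum>m\<le>i. e m) * (z $ (i + 1) - z $ i)"
      unfolding \<eta>_slope[OF i] by (simp add: d_def inv_gap_def)
  qed simp
  also have "\<dots> = (\<Sum>m<M. e m) * z $ (K + 1) - (\<Sum>m<M. e m * z $ m)"
    using summation_by_parts_outer[of e "\<lambda>i. z $ i" "K + 1"] K by (simp add: lessThan_Suc_atMost[symmetric])
  finally show ?thesis using moment0 by simp
qed

lemma transpose_L_mat_knot_values: "transpose_mat (L_mat x) *\<^sub>v knot_values = vec M e"
proof (rule eq_vecI)
  fix j assume "j < dim_vec (vec M e)"
  then have j: "j < M" by simp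
  have u: "unit_vec M j \<in> carrier_vec M" by simp
  have "(transpose_mat (L_mat x) *\<^sub>v knot_values) $ j = (transpose_mat (L_mat x) *\<^sub>v knot_values) \<bullet> unit_vec M j"
    using j L_mat_carrier by (subst scalar_prod_right_unit) auto
  also have "\<dots> = knot_values \<bullet> (L_mat x *\<^sub>v unit_vec M j)"
    by (rule transpose_vec_mult_scalar[OF L_mat_carrier u knot_values_carrier])
  also have "\<dots> = (\<Sum>m<M. e m * unit_vec M j $ m)" by (rule knot_values_pairing[OF u])
  also have "\<dots> = (\<Sum>m<M. if m = j then e m else 0)"
    by (intro sum.cong) (auto simp: unit_vec_def)
  also have "\<dots> = vec M e $ j" using j by (simp add: sum.delta)
  finally show "(transpose_mat (L_mat x) *\<^sub>v knot_values) $ j = vec M e $ j" .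
qed (use L_mat_carrier in auto)

text \<open>The first M - 2 rows of L^T form a lower triangular matrix whose diagonal consists of the inverse
gaps.\<close>

lemma transpose_L_mat_injective:
  assumes u: "u \<in> carrier_vec (M - 2)" and 0: "transpose_mat (L_mat x) *\<^sub>v u = 0\<^sub>v M"
  shows "u = 0\<^sub>v (M - 2)"
proof (rule eq_vecI)
  fix i assume "i < dim_vec (0\<^sub>v (M - 2) :: real vec)"
  then have "i < M - 2" by simp
  then have "u $ i = 0"
  proof (induction i rule: less_induct)
    case (less i)
    have "0 = (transpose_mat (L_mat x) *\<^sub>v u) $ i" using 0 less.prems by simp
    also have "\<dots> = (\<Sum>l\<in>{0..<M - 2}. L_mat x $$ (l, i) * u $ l)"
      using less.prems u x_dim by (simp add: L_mat_def scalar_prod_def)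
    also have "\<dots> = (\<Sum>l\<in>{i}. L_mat x $$ (l, i) * u $ l)"
    proof (rule sum.mono_neutral_right)
      show "\<forall>l\<in>{0..<M - 2} - {i}. L_mat x $$ (l, i) * u $ l = 0"
      proof
        fix l assume l: "l \<in> {0..<M - 2} - {i}"
        show "L_mat x $$ (l, i) * u $ l = 0"
        proof (cases "l < i")
          case True
          then show ?thesis using less.IH[of l] l by simp
        next
          case False
          then show ?thesis using l less.prems carrier_vecD[OF x_dim] less_le_trans[OF less.prems diff_le_self]
            by (simp add: L_mat_def)
        qed
      qed
    qed (use less.prems in auto)
    also have "\<dots> = inv_gap x i * u $ i" using less.prems x_dim by (simp add: L_mat_def)
    finally have "inv_gap x i * u $ i = 0" by simp
    moreover have "x $ i < x $ (i + 1)" using less.prems by (intro incr) auto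
    ultimately show ?case by (simp add: inv_gap_def)
  qed
  then show "u $ i = 0\<^sub>v (M - 2) $ i" using \<open>i < M - 2\<close> by simp
qed (use u in simp)

text \<open>Together with the bound on \<eta> this identifies lambda_max with the supremum of |\<eta>|, since
the knot values solve L^T u = e and L^T is injective.\<close>

lemma pseudoinverse_weights:
  "pseudoinverse (transpose_mat (L_mat x)) *\<^sub>v vec M e = knot_values"
  using pseudoinverse_injective[OF transpose_carrier_mat[THEN iffD2, OF L_mat_carrier]
      transpose_L_mat_injective knot_values_carrier]
  by (simp add: transpose_L_mat_knot_values)

lemma \<eta>_le_linf_norm: "\<bar>\<eta> \<tau>\<bar> \<le> linf_norm knot_values"
proof (rule \<eta>_bound)
  show "0 \<le> linf_norm knot_values" unfolding linf_norm_def by (intro Max_ge) auto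
  show "\<bar>\<eta> (x $ (i + 1))\<bar> \<le> linf_norm knot_values" if "i < M - 2" for i
    unfolding linf_norm_def using that
    by (intro Max_ge) (auto simp: knot_values_def intro!: image_eqI[of _ _ i])
qed

lemma pairing_le_l1_norm:
  assumes "z \<in> carrier_vec M"
  shows "- (\<Sum>m<M. e m * z $ m) \<le> linf_norm knot_values * l1_norm (L_mat x *\<^sub>v z)"
proof -
  have dim: "dim_vec (L_mat x *\<^sub>v z) = M - 2" using L_mat_carrier by simp
  have "knot_values \<bullet> (L_mat x *\<^sub>v z) = (\<Sum>i<M - 2. \<eta> (x $ (i + 1)) * (L_mat x *\<^sub>v z) $ i)"
    unfolding scalar_prod_def dim lessThan_atLeast0 by (intro sum.cong) (auto simp: knot_values_def)
  then have "- (\<Sum>m<M. e m * z $ m) = (\<Sum>i<M - 2. - (\<eta> (x $ (i + 1)) * (L_mat x *\<^sub>v z) $ i))"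
    by (simp add: knot_values_pairing[OF assms] sum_negf)
  also have "\<dots> \<le> (\<Sum>i<M - 2. linf_norm knot_values * \<bar>(L_mat x *\<^sub>v z) $ i\<bar>)"
  proof (rule sum_mono)
    fix i
    have "- (\<eta> (x $ (i + 1)) * (L_mat x *\<^sub>v z) $ i) \<le> \<bar>\<eta> (x $ (i + 1))\<bar> * \<bar>(L_mat x *\<^sub>v z) $ i\<bar>"
      by (metis abs_ge_minus_self abs_mult)
    also have "\<dots> \<le> linf_norm knot_values * \<bar>(L_mat x *\<^sub>v z) $ i\<bar>"
      by (intro mult_right_mono \<eta>_le_linf_norm) simp
    finally show "- (\<eta> (x $ (i + 1)) * (L_mat x *\<^sub>v z) $ i) \<le> linf_norm knot_values * \<bar>(L_mat x *\<^sub>v z) $ i\<bar>" .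
  qed
  finally show ?thesis unfolding l1_norm_def dim sum_distrib_left .
qed

end

section \<open>Strict convexity and linear regression\<close>

text \<open>Strictness comes from the midpoint: there f lies strictly below the chord and still not below the
tangent.\<close>

lemma strictly_convex_above_tangent:
  assumes conv: "strictly_convex f" and diff: "f differentiable at p"
  shows "f s \<ge> f p + deriv f p * (s - p)"
    and "s \<noteq> p \<Longrightarrow> f s > f p + deriv f p * (s - p)"
proof -
  have "convex_on UNIV f"
  proof (rule convex_onI)
    fix t x y :: real assume t: "0 < t" "t < 1"
    show "f ((1 - t) *\<^sub>R x + t *\<^sub>R y) \<le> (1 - t) * f x + t * f y"
    proof (cases "x = y")
      case False
      then show ?thesis
        using conv[unfolded strictly_convex_def, rule_format, of x y "1 - t"] t by simp
    qed (simp add: algebra_simps)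
  qed simp
  moreover have "(f has_real_derivative deriv f p) (at p)"
    using diff by (simp add: DERIV_deriv_iff_real_differentiable)
  ultimately have tangent: "f p + deriv f p * (s - p) \<le> f s" for s
    using convex_on_imp_above_tangent[of UNIV f p s "deriv f p"] by simp
  then show "f s \<ge> f p + deriv f p * (s - p)" .
  show "f s > f p + deriv f p * (s - p)" if "s \<noteq> p"
  proof -
    have "f (1 / 2 * s + (1 - 1 / 2) * p) < 1 / 2 * f s + (1 - 1 / 2) * f p"
      using conv[unfolded strictly_convex_def, rule_format, of s p "1 / 2"] that by simp
    moreover have "f p + deriv f p * (1 / 2 * s + (1 - 1 / 2) * p - p) \<le> f (1 / 2 * s + (1 - 1 / 2) * p)"
      by (rule tangent)
    ultimately show ?thesis by (simp add: field_simps)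
  qed
qed

locale regression_data =
  fixes M :: nat and x y :: "real vec" and E :: "real \<Rightarrow> real \<Rightarrow> real"
  assumes M2: "M \<ge> 2"
    and x_dim: "x \<in> carrier_vec M"
    and incr: "\<And>i j. i < j \<Longrightarrow> j < M \<Longrightarrow> x $ i < x $ j"
    and nonneg: "\<And>s t. E s t \<ge> 0"
    and convex: "\<And>t. strictly_convex (\<lambda>s. E s t)"
    and coercive: "\<And>t. coercive (\<lambda>s. E s t)"
    and diff: "\<And>s t. (\<lambda>s. E s t) differentiable (at s)"
begin

definition line :: "real \<times> real \<Rightarrow> nat \<Rightarrow> real" where
  "line \<beta> m = fst \<beta> + snd \<beta> * x $ m"

definition fit :: "(nat \<Rightarrow> real) \<Rightarrow> real" where
  "fit z = (\<Sum>m<M. E (z m) (y $ m))"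

definition residual_slope :: "real \<times> real \<Rightarrow> nat \<Rightarrow> real" where
  "residual_slope \<beta> m = deriv (\<lambda>s. E s (y $ m)) (line \<beta> m)"

lemma regression_cost_eq: "regression_cost E x y \<beta> = fit (line \<beta>)"
  using x_dim by (cases \<beta>) (simp add: regression_cost_def fit_def line_def)

lemma E_DERIV: "((\<lambda>s. E s t) has_real_derivative deriv (\<lambda>s. E s t) s) (at s)"
  using diff by (simp add: DERIV_deriv_iff_real_differentiable)

lemma fit_above_tangent:
  assumes "\<exists>m<M. z m \<noteq> line \<beta> m"
  shows "fit z > fit (line \<beta>) + (\<Sum>m<M. residual_slope \<beta> m * (z m - line \<beta> m))"
  unfolding fit_def residual_slope_def sum.distrib[symmetric]
  using assms
  by (intro sum_strict_mono_ex1 ballI strictly_convex_above_tangent(1)[OF convex diff])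
    (auto intro: strictly_convex_above_tangent(2)[OF convex diff])

lemma regression_stationary:
  assumes min: "\<And>\<beta>'. fit (line \<beta>) \<le> fit (line \<beta>')"
  shows "(\<Sum>m<M. residual_slope \<beta> m) = 0" "(\<Sum>m<M. residual_slope \<beta> m * x $ m) = 0"
proof -
  have along: "(\<Sum>m<M. residual_slope \<beta> m * (c + d * x $ m)) = 0" for c d
  proof -
    let ?l = "\<lambda>s. line (fst \<beta> + s * c, snd \<beta> + s * d)"
    have l: "?l s m = line \<beta> m + s * (c + d * x $ m)" for s m
      by (simp add: line_def algebra_simps)
    have "((\<lambda>s. E (line \<beta> m + s * (c + d * x $ m)) (y $ m)) has_real_derivative
        residual_slope \<beta> m * (c + d * x $ m)) (at 0)" for m
    proof -
      have inner: "((\<lambda>s. line \<beta> m + s * (c + d * x $ m)) has_real_derivative (c + d * x $ m)) (at 0)"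
        by (auto intro!: derivative_eq_intros)
      show ?thesis
        using DERIV_chain2[OF _ inner, of "\<lambda>s. E s (y $ m)" "residual_slope \<beta> m"] E_DERIV
        by (simp add: residual_slope_def)
    qed
    then have D: "((\<lambda>s. fit (?l s)) has_real_derivative (\<Sum>m<M. residual_slope \<beta> m * (c + d * x $ m))) (at 0)"
      unfolding fit_def l by (intro DERIV_sum)
    show ?thesis
      using DERIV_local_min[OF D, of 1] min by simp
  qed
  show "(\<Sum>m<M. residual_slope \<beta> m) = 0" using along[of 1 0] by simp
  show "(\<Sum>m<M. residual_slope \<beta> m * x $ m) = 0" using along[of 0 1] by simp
qed

lemma affine_pairing_0:
  assumes "\<And>\<beta>'. fit (line \<beta>) \<le> fit (line \<beta>')"
  shows "(\<Sum>m<M. residual_slope \<beta> m * line \<beta>' m) = 0"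
proof -
  have "(\<Sum>m<M. residual_slope \<beta> m * line \<beta>' m)
      = fst \<beta>' * (\<Sum>m<M. residual_slope \<beta> m) + snd \<beta>' * (\<Sum>m<M. residual_slope \<beta> m * x $ m)"
    by (simp add: line_def sum_distrib_left algebra_simps flip: sum.distrib)
  then show ?thesis using regression_stationary[OF assms] by simp
qed

text \<open>The residual slopes of the regression line annihilate all affine data, so only the pairing with z
itself survives from the tangent inequality. Both penalized problems are reduced by this lemma to
a lower bound of that pairing.\<close>

lemma fit_above_minimal_line:
  assumes "\<And>\<beta>'. fit (line \<beta>) \<le> fit (line \<beta>')" "\<exists>m<M. z m \<noteq> line \<beta> m"
  shows "fit z > fit (line \<beta>) + (\<Sum>m<M. residual_slope \<beta> m * z m)"
  using fit_above_tangent[OF assms(2)] affine_pairing_0[OF assms(1), of \<beta>]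
  by (simp add: right_diff_distrib sum_subtractf)

lemma line_inj:
  assumes "line \<beta> 0 = line \<beta>' 0" "line \<beta> 1 = line \<beta>' 1"
  shows "\<beta> = \<beta>'"
proof -
  have "x $ 0 < x $ 1" using incr[of 0 1] M2 by simp
  moreover have "(snd \<beta> - snd \<beta>') * (x $ 1 - x $ 0) = 0"
    using assms by (simp add: line_def algebra_simps)
  ultimately have "snd \<beta> = snd \<beta>'" by simp
  then show ?thesis using assms(1) by (simp add: line_def prod_eq_iff)
qed

lemma regression_minimizer_unique:
  assumes "\<And>\<beta>'. fit (line \<beta>) \<le> fit (line \<beta>')" "\<beta>' \<noteq> \<beta>"
  shows "fit (line \<beta>) < fit (line \<beta>')"
proof -
  have "\<exists>m<M. line \<beta>' m \<noteq> line \<beta> m" using line_inj[of \<beta>' \<beta>] assms(2) M2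
    by (metis less_le_trans one_less_numeral_iff pos2 semiring_norm(76))
  then show ?thesis
    using fit_above_minimal_line[OF assms(1), of "line \<beta>'"] affine_pairing_0[OF assms(1), of \<beta>'] by simp
qed

lemma fit_line_continuous: "continuous_on A (\<lambda>\<beta>. fit (line \<beta>))"
proof -
  have "continuous_on UNIV (\<lambda>s. E s t)" for t
    using E_DERIV DERIV_isCont by (blast intro: continuous_at_imp_continuous_on)
  then have "continuous_on A (\<lambda>\<beta>. E (line \<beta> m) (y $ m))" for m
    unfolding line_def by (rule continuous_on_compose2) (auto intro!: continuous_intros)
  then show ?thesis unfolding fit_def by (intro continuous_intros)
qed

text \<open>By nonnegativity a sublevel set of the total cost lies in sublevel sets of single terms. By
coercivity of the first two terms the line is bounded at two distinct abscissae, which bounds both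
coefficients; a continuous cost on a compact rectangle attains its minimum.\<close>

lemma regression_minimizer_exists: "\<exists>\<beta>. \<forall>\<beta>'. fit (line \<beta>) \<le> fit (line \<beta>')"
proof -
  define c where "c = fit (line (0, 0))"
  have "\<exists>R. \<forall>s. E s t \<le> c \<longrightarrow> \<bar>s\<bar> \<le> R" for t
  proof -
    have "\<forall>\<^sub>F s in at_infinity. c + 1 \<le> E s t"
      using coercive[of t] by (simp add: coercive_def filterlim_at_top)
    then obtain R where R: "\<And>s. R \<le> \<bar>s\<bar> \<Longrightarrow> c + 1 \<le> E s t"
      by (auto simp: eventually_at_infinity)
    have "\<bar>s\<bar> \<le> R" if "E s t \<le> c" for s using R[of s] that by linarith
    then show ?thesis by blast
  qed
  then obtain R where R: "\<And>t s. E s t \<le> c \<Longrightarrow> \<bar>s\<bar> \<le> R t" by metis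
  define a where "a = R (y $ 0)"
  define b where "b = R (y $ 1)"
  define g where "g = x $ 1 - x $ 0"
  have g: "g > 0" using incr[of 0 1] M2 by (simp add: g_def)
  \<comment> \<open>Two values bounded by a and b at distance g bound the slope by B1, and then the intercept by B0.\<close>
  define B1 where "B1 = (a + b) / g"
  define B0 where "B0 = a + B1 * \<bar>x $ 0\<bar>"
  let ?K = "{- B0..B0} \<times> {- B1..B1}"
  have sub: "\<beta> \<in> ?K" if \<beta>: "fit (line \<beta>) \<le> c" for \<beta>
  proof -
    have "E (line \<beta> m) (y $ m) \<le> c" if "m < M" for m
    proof -
      have "E (line \<beta> m) (y $ m) \<le> fit (line \<beta>)"
        unfolding fit_def using that nonneg by (intro member_le_sum) auto
      then show ?thesis using \<beta> by simp
    qed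
    then have 0: "\<bar>line \<beta> 0\<bar> \<le> a" and 1: "\<bar>line \<beta> 1\<bar> \<le> b"
      unfolding a_def b_def using M2 by (auto intro!: R)
    have "\<bar>snd \<beta>\<bar> * g = \<bar>line \<beta> 1 - line \<beta> 0\<bar>"
      using g by (simp add: line_def g_def abs_mult right_diff_distrib[symmetric])
    also have "\<dots> \<le> a + b" using 0 1 by linarith
    finally have s: "\<bar>snd \<beta>\<bar> \<le> B1" using g by (simp add: B1_def pos_le_divide_eq)
    have "\<bar>fst \<beta>\<bar> = \<bar>line \<beta> 0 - snd \<beta> * x $ 0\<bar>" by (simp add: line_def)
    also have "\<dots> \<le> a + \<bar>snd \<beta>\<bar> * \<bar>x $ 0\<bar>"
      using 0 abs_triangle_ineq4[of "line \<beta> 0" "snd \<beta> * x $ 0"] by (simp add: abs_mult)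
    also have "\<dots> \<le> B0" unfolding B0_def using s by (simp add: mult_right_mono)
    finally show ?thesis using s by (auto simp: mem_Times_iff abs_le_iff)
  qed
  have "(0, 0) \<in> ?K" by (rule sub) (simp add: c_def)
  then obtain \<beta> where \<beta>: "\<beta> \<in> ?K" "\<And>\<beta>'. \<beta>' \<in> ?K \<Longrightarrow> fit (line \<beta>) \<le> fit (line \<beta>')"
    using continuous_attains_inf[of ?K, OF _ _ fit_line_continuous] compact_Times[OF compact_Icc compact_Icc]
    by blast
  have "fit (line \<beta>) \<le> fit (line \<beta>')" for \<beta>'
  proof (cases "\<beta>' \<in> ?K")
    case False
    then have "c < fit (line \<beta>')" using sub by (meson linorder_not_less)
    moreover have "fit (line \<beta>) \<le> c" unfolding c_def by (rule \<beta>(2)) fact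
    ultimately show ?thesis by simp
  qed (rule \<beta>(2))
  then show ?thesis by blast
qed

end

section \<open>The discrete problem\<close>

locale optimal_line = regression_data +
  fixes \<beta> :: "real \<times> real"
  assumes optimal: "\<And>\<beta>'. fit (line \<beta>) \<le> fit (line \<beta>')"
begin

sublocale moment_free_weights M x "residual_slope \<beta>"
  by unfold_locales (use M2 x_dim incr regression_stationary[OF optimal] in auto)

lemma lambda_max_eq: "lambda_max E x y (fst \<beta>) (snd \<beta>) = linf_norm knot_values"
  using x_dim pseudoinverse_weights
  by (simp add: lambda_max_def residual_slope_def[abs_def] line_def)

lemma line_second_differences_0:
  assumes z: "z \<in> carrier_vec M" and "\<And>m. m < M \<Longrightarrow> z $ m = line \<beta>' m"
  shows "L_mat x *\<^sub>v z = 0\<^sub>v (M - 2)"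
proof (rule eq_vecI)
  fix i assume "i < dim_vec (0\<^sub>v (M - 2) :: real vec)"
  then have i: "i < M - 2" by simp
  have slope: "inv_gap x j * (z $ (j + 1) - z $ j) = snd \<beta>'" if "j + 1 < M" for j
  proof -
    have "z $ (j + 1) - z $ j = snd \<beta>' * (x $ (j + 1) - x $ j)"
      using assms(2)[of "j + 1"] assms(2)[of j] that by (simp add: line_def algebra_simps)
    moreover have "x $ j < x $ (j + 1)" using that by (intro incr) auto
    ultimately show ?thesis by (simp add: inv_gap_def)
  qed
  show "(L_mat x *\<^sub>v z) $ i = 0\<^sub>v (M - 2) $ i"
    using L_mat_mult_vec[OF z i] slope[of i] slope[of "i + 1"] i by simp
qed (use L_mat_carrier in simp)

definition fitted :: "real vec" where "fitted = vec M (line \<beta>)"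

lemma discrete_cost_eq: "discrete_cost E x y lam z = fit (\<lambda>m. z $ m) + lam * l1_norm (L_mat x *\<^sub>v z)"
  using x_dim by (simp add: discrete_cost_def fit_def)

lemma discrete_cost_fitted: "discrete_cost E x y lam fitted = fit (line \<beta>)"
proof -
  have "L_mat x *\<^sub>v fitted = 0\<^sub>v (M - 2)"
    by (rule line_second_differences_0[of _ \<beta>]) (auto simp: fitted_def)
  then show ?thesis by (simp add: discrete_cost_eq l1_norm_def fit_def fitted_def)
qed

text \<open>Off the regression line the fit grows strictly more than the pairing with the residual slopes, and
the penalty compensates that pairing once \<lambda> \<ge> lambda_max.\<close>

lemma discrete_cost_less:
  assumes lam: "linf_norm knot_values \<le> lam" and z: "z \<in> carrier_vec M" "z \<noteq> fitted"
  shows "discrete_cost E x y lam fitted < discrete_cost E x y lam z"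
proof -
  have "\<exists>m<M. z $ m \<noteq> line \<beta> m"
  proof (rule ccontr)
    assume "\<not> (\<exists>m<M. z $ m \<noteq> line \<beta> m)"
    then have "z = fitted" using z(1) by (intro eq_vecI) (auto simp: fitted_def)
    then show False using z(2) by simp
  qed
  then have "fit (\<lambda>m. z $ m) > fit (line \<beta>) + (\<Sum>m<M. residual_slope \<beta> m * z $ m)"
    using fit_above_minimal_line[OF optimal, of "\<lambda>m. z $ m"] by simp
  moreover have "- (\<Sum>m<M. residual_slope \<beta> m * z $ m) \<le> lam * l1_norm (L_mat x *\<^sub>v z)"
    using pairing_le_l1_norm[OF z(1)] mult_right_mono[OF lam, of "l1_norm (L_mat x *\<^sub>v z)"]
    by (simp add: l1_norm_def sum_nonneg)
  ultimately show ?thesis unfolding discrete_cost_fitted by (simp add: discrete_cost_eq)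
qed

section \<open>The continuous problem\<close>

definition fitted_line :: functional where
  "fitted_line = distribution_of (\<lambda>t. fst \<beta> + snd \<beta> * t)"

lemma gblasso_cost_eq:
  assumes "continuous_representative T g" "represented_by_measure (D2 T) \<nu>"
  shows "gblasso_cost E x y lam T = fit (\<lambda>m. g (x $ m)) + lam * total_variation \<nu>"
  using x_dim
  by (simp add: gblasso_cost_def fit_def point_value_eq[OF assms(1)] measure_norm_eq[OF assms(2)])

lemma gblasso_cost_fitted: "gblasso_cost E x y lam fitted_line = fit (line \<beta>)"
  unfolding fitted_line_def gblasso_cost_eq[OF affine_continuous_representative affine_D2]
  by (simp add: total_variation_zero_measure line_def[abs_def])

text \<open>The correction term of the kernel contributes the sum of the weights, which is 0.\<close>

lemma pairing_potential:
  assumes \<mu>: "finite_borel_measure \<mu>"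
  shows "(\<Sum>m<M. residual_slope \<beta> m * potential \<mu> (x $ m)) = (LINT \<tau>|\<mu>. \<eta> \<tau>)"
proof -
  have "(\<Sum>m<M. residual_slope \<beta> m * potential \<mu> (x $ m))
      = (LINT \<tau>|\<mu>. (\<Sum>m<M. residual_slope \<beta> m * green (x $ m) \<tau>))"
    unfolding potential_def using integrable_green[OF \<mu>]
    by (subst Bochner_Integration.integral_sum) auto
  also have "(\<lambda>\<tau>. \<Sum>m<M. residual_slope \<beta> m * green (x $ m) \<tau>) = \<eta>"
    using moment0 unfolding green_def dual_spline_def
    by (simp add: fun_eq_iff right_diff_distrib sum_subtractf flip: sum_distrib_right)
  finally show ?thesis .
qed

text \<open>If f misses the regression line at a data point, the argument for the discrete problem applies
with the integral of \<eta> in place of the finite pairing. Otherwise the fits agree and the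
penalty decides: since \<lambda> > 0 it is positive unless f is affine, and an affine function
through two points of the line is the line.\<close>

lemma gblasso_cost_less:
  assumes lam: "lam > 0" "linf_norm knot_values \<le> lam"
    and T: "T \<in> BV2" "T \<noteq> fitted_line"
  shows "gblasso_cost E x y lam fitted_line < gblasso_cost E x y lam T"
proof -
  obtain \<nu> where temp: "T \<in> tempered_distributions" and \<nu>: "represented_by_measure (D2 T) \<nu>"
    using T(1) by (auto simp: BV2_def)
  obtain P N a b where dec: "signed_decomposition \<nu> P N"
    and rep: "continuous_representative T (\<lambda>t. a + b * t + (potential P t - potential N t))"
    using BV2_continuous_representative[OF temp \<nu>] .
  have fin: "finite_borel_measure P" "finite_borel_measure N"
    using dec by (auto simp: signed_decomposition_def)
  define g where "g t = a + b * t + (potential P t - potential N t)" for t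
  have cost: "gblasso_cost E x y lam T = fit (\<lambda>m. g (x $ m)) + lam * total_variation \<nu>"
    unfolding g_def by (rule gblasso_cost_eq[OF rep \<nu>])
  show ?thesis
  proof (cases "\<exists>m<M. g (x $ m) \<noteq> line \<beta> m")
    case True
    have "(\<Sum>m<M. residual_slope \<beta> m * g (x $ m))
        = (\<Sum>m<M. residual_slope \<beta> m * line (a, b) m)
          + ((\<Sum>m<M. residual_slope \<beta> m * potential P (x $ m)) - (\<Sum>m<M. residual_slope \<beta> m * potential N (x $ m)))"
      by (simp add: g_def line_def distrib_left[of _ "a + _"] right_diff_distrib sum.distrib sum_subtractf)
    also have "\<dots> = (LINT \<tau>|P. \<eta> \<tau>) - (LINT \<tau>|N. \<eta> \<tau>)"
      by (simp add: affine_pairing_0[OF optimal] pairing_potential fin)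
    finally have "- (\<Sum>m<M. residual_slope \<beta> m * g (x $ m))
        = (LINT \<tau>|P. - \<eta> \<tau>) - (LINT \<tau>|N. - \<eta> \<tau>)" by simp
    also have "\<dots> \<le> linf_norm knot_values * total_variation \<nu>"
      using \<eta>_le_linf_norm
      by (intro integral_le_total_variation[OF dec])
        (auto intro!: borel_measurable_continuous_onI continuous_intros dual_spline_continuous)
    also have "\<dots> \<le> lam * total_variation \<nu>"
      by (intro mult_right_mono lam total_variation_nonneg[OF dec])
    finally show ?thesis
      using fit_above_minimal_line[OF optimal True] unfolding gblasso_cost_fitted cost by simp
  next
    case False
    then have g: "g (x $ m) = line \<beta> m" if "m < M" for m using that by blast
    have "total_variation \<nu> \<noteq> 0"
    proof
      assume "total_variation \<nu> = 0"
      then have zero: "\<nu> = zero_measure" by (rule total_variation_eq_0D[OF dec])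
      have "P = N"
      proof (rule measure_eqI)
        show "sets P = sets N" using finite_borel_measure_facts(1) fin by simp
        fix A assume "A \<in> sets P"
        then have "A \<in> sets borel" using finite_borel_measure_facts(1)[OF fin(1)] by simp
        then have "\<nu> A = measure P A - measure N A"
          using dec by (simp add: signed_decomposition_def)
        moreover have "\<nu> A = 0" using zero \<open>A \<in> sets borel\<close> by (simp add: zero_measure_def)
        ultimately have "measure P A = measure N A" by simp
        then show "emeasure P A = emeasure N A"
          using fin[THEN finite_borel_measure_facts(3)]
          by (simp add: finite_measure.emeasure_eq_measure)
      qed
      then have affine: "g = (\<lambda>t. a + b * t)" by (simp add: g_def[abs_def])
      have "(a, b) = \<beta>"
        using g[of 0] g[of 1] M2 by (intro line_inj) (simp_all add: affine line_def)
      then have "T = fitted_line"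
        using rep affine unfolding g_def[symmetric] fitted_line_def continuous_representative_def by auto
      then show False using T(2) by simp
    qed
    then have "total_variation \<nu> > 0" using total_variation_nonneg[OF dec] by simp
    moreover have "fit (\<lambda>m. g (x $ m)) = fit (line \<beta>)" using g by (simp add: fit_def)
    ultimately show ?thesis using lam(1) unfolding gblasso_cost_fitted cost by simp
  qed
qed

end

section \<open>Unique minimizers\<close>

lemma unique_arg_min:
  assumes "P a" "\<And>b. P b \<Longrightarrow> b \<noteq> a \<Longrightarrow> f a < (f b :: real)"
  shows "{b. is_arg_min f P b} = {a}"
  using assms unfolding is_arg_min_def by force

theorem proposition10:
  fixes M :: nat and x y :: "real vec" and E :: "real \<Rightarrow> real \<Rightarrow> real"
  assumes "M \<ge> 2"
    and "x \<in> carrier_vec M" and "y \<in> carrier_vec M"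
    and "\<And>i j. i < j \<Longrightarrow> j < M \<Longrightarrow> x $ i < x $ j"
    and "\<And>s t. E s t \<ge> 0"
    and "\<And>t. strictly_convex (\<lambda>s. E s t)"
    and "\<And>t. coercive (\<lambda>s. E s t)"
    and "\<And>s t. (\<lambda>s. E s t) differentiable (at s)"
  shows "(\<exists>!\<beta>. is_arg_min (regression_cost E x y) (\<lambda>_. True) \<beta>) \<and>
    (\<forall>\<beta>0 \<beta>1. is_arg_min (regression_cost E x y) (\<lambda>_. True) (\<beta>0, \<beta>1) \<longrightarrow>
      (\<forall>lam. lam > 0 \<and> lam \<ge> lambda_max E x y \<beta>0 \<beta>1 \<longrightarrow>
        {z. is_arg_min (discrete_cost E x y lam) (\<lambda>z. z \<in> carrier_vec M) z} =
          {\<beta>0 \<cdot>\<^sub>v vec M (\<lambda>_. 1) + \<beta>1 \<cdot>\<^sub>v x} \<and>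
        {T. is_arg_min (gblasso_cost E x y lam) (\<lambda>T. T \<in> BV2) T} =
          {distribution_of (\<lambda>t. \<beta>0 + \<beta>1 * t)}))"
proof -
  interpret regression_data M x y E by unfold_locales (use assms in auto)
  have arg_min: "is_arg_min (regression_cost E x y) (\<lambda>_. True) \<beta> \<longleftrightarrow> (\<forall>\<beta>'. fit (line \<beta>) \<le> fit (line \<beta>'))" for \<beta>
    by (simp add: is_arg_min_def regression_cost_eq linorder_not_less)
  have "\<exists>!\<beta>. is_arg_min (regression_cost E x y) (\<lambda>_. True) \<beta>"
    unfolding arg_min
    using regression_minimizer_exists regression_minimizer_unique by (metis linorder_not_less)
  moreover have "{z. is_arg_min (discrete_cost E x y lam) (\<lambda>z. z \<in> carrier_vec M) z} =
          {\<beta>0 \<cdot>\<^sub>v vec M (\<lambda>_. 1) + \<beta>1 \<cdot>\<^sub>v x} \<and>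
        {T. is_arg_min (gblasso_cost E x y lam) (\<lambda>T. T \<in> BV2) T} =
          {distribution_of (\<lambda>t. \<beta>0 + \<beta>1 * t)}"
    if opt: "is_arg_min (regression_cost E x y) (\<lambda>_. True) (\<beta>0, \<beta>1)"
      and lam: "lam > 0" "lam \<ge> lambda_max E x y \<beta>0 \<beta>1" for \<beta>0 \<beta>1 lam
  proof -
    interpret optimal_line M x y E "(\<beta>0, \<beta>1)"
      by unfold_locales (use opt arg_min in auto)
    have lam': "linf_norm knot_values \<le> lam" using lam(2) lambda_max_eq by simp
    have "fitted = \<beta>0 \<cdot>\<^sub>v vec M (\<lambda>_. 1) + \<beta>1 \<cdot>\<^sub>v x"
      using x_dim by (intro eq_vecI) (auto simp: fitted_def line_def)
    moreover have "fitted_line = distribution_of (\<lambda>t. \<beta>0 + \<beta>1 * t)"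
      by (simp add: fitted_line_def)
    moreover have "{z. is_arg_min (discrete_cost E x y lam) (\<lambda>z. z \<in> carrier_vec M) z} = {fitted}"
      by (rule unique_arg_min) (simp add: fitted_def, rule discrete_cost_less[OF lam'])
    moreover have "{T. is_arg_min (gblasso_cost E x y lam) (\<lambda>T. T \<in> BV2) T} = {fitted_line}"
      by (rule unique_arg_min) (simp add: fitted_line_def affine_BV2, rule gblasso_cost_less[OF lam(1) lam'])
    ultimately show ?thesis by (simp only:)
  qed
  ultimately show ?thesis by blast
qed

end
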